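(* Let $\mathbb{K}$ be a field, $S=\mathbb{K}[x_1,\ldots,x_n]$ with $n\ge 6$, and let $I\subseteq S$ be a support-$2$ monomial ideal such that $G(I)=C_n$, the cycle on $x_1,\ldots,x_n$. Then the following are equivalent: (1) $I$ does not have any embedded associated primes; (2) $I$ has a standard linear weighting. Moreover, $I^{(s)}=I^s$ for all $s\ge 1$ if and only if $n$ is even and $I$ has a standard linear weighting.
   Context: For a monomial ideal $I$, $\mathcal{G}(I)$ denotes its minimal set of monomial generators. $I$ is a support-$2$ monomial ideal if $\mathcal{G}(I)\subseteq\{x_i^ax_j^b : 1\le i<j\le n,\ a,b\ge 1\}$. The underlying simple graph $G(I)$ has vertices $x_1,\ldots,x_n$ and an edge $\{x_i,x_j\}$ whenever some element of $\mathcal{G}(I)$ has support $\{x_i,x_j\}$; $\sqrt{I}$ is the edge ideal of $G(I)$. Symbolic power: $I^{(s)}=\bigcap_{P\in\mathrm{MinAss}(I)}(I^sS_P\cap S)$ over the minimal primes of $I$. A standard linear weighting is a map $w(a_1,\ldots,a_n)=(d_1a_1,\ldots,d_na_n)$ with fixed positive integers $d_i$; for a monomial ideal $J$, $J_w$ is generated by the monomials obtained from $\mathcal{G}(J)$ by replacing each $x_i$ by $x_i^{d_i}$. "$I$ has a standard linear weighting" means $I=(\sqrt{I})_w$ for some standard linear weighting $w$. *)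

theory Defs
  imports Main "HOL-Library.Poly_Mapping"
begin

text \<open>Polynomials over a field k in the variables x_0, x_1, ... : finitely supported
  maps from monomials (exponent vectors nat =>0 nat) to coefficients; multiplication is
  the convolution product of Poly_Mapping.  The paper's x_1..x_n are x_0..x_(n-1) here.\<close>

type_synonym ('k) mpoly = "(nat \<Rightarrow>\<^sub>0 nat) \<Rightarrow>\<^sub>0 'k"

definition polyring :: "nat \<Rightarrow> ('k::field) mpoly set" where
  "polyring n = {p::'k mpoly. \<forall>m::nat \<Rightarrow>\<^sub>0 nat\<in>Poly_Mapping.keys p. Poly_Mapping.keys m \<subseteq> {..<n}}"

definition monom :: "(nat \<Rightarrow>\<^sub>0 nat) \<Rightarrow> ('k::field) mpoly" where
  "monom m = Poly_Mapping.single m 1"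

definition monomials :: "nat \<Rightarrow> (nat \<Rightarrow>\<^sub>0 nat) set" where
  "monomials n = {m. Poly_Mapping.keys m \<subseteq> {..<n}}"

definition mdvd :: "(nat \<Rightarrow>\<^sub>0 nat) \<Rightarrow> (nat \<Rightarrow>\<^sub>0 nat) \<Rightarrow> bool" where
  "mdvd a b \<longleftrightarrow> (\<forall>i. Poly_Mapping.lookup a i \<le> Poly_Mapping.lookup b i)"

definition is_ideal :: "nat \<Rightarrow> ('k::field) mpoly set \<Rightarrow> bool" where
  "is_ideal n I \<longleftrightarrow> I \<subseteq> polyring n \<and> 0 \<in> I \<and>
     (\<forall>f\<in>I. \<forall>g\<in>I. f + g \<in> I) \<and> (\<forall>f\<in>I. \<forall>g\<in>polyring n. g * f \<in> I)"

definition gen_ideal :: "nat \<Rightarrow> ('k::field) mpoly set \<Rightarrow> 'k mpoly set" where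
  "gen_ideal n G = \<Inter>{J. is_ideal n J \<and> G \<subseteq> J}"

definition is_monomial_ideal :: "nat \<Rightarrow> ('k::field) mpoly set \<Rightarrow> bool" where
  "is_monomial_ideal n I \<longleftrightarrow> (\<exists>M\<subseteq>monomials n. I = gen_ideal n (monom ` M))"

definition min_gens :: "nat \<Rightarrow> ('k::field) mpoly set \<Rightarrow> (nat \<Rightarrow>\<^sub>0 nat) set" where
  "min_gens n I = {m \<in> monomials n. monom m \<in> I \<and>
      (\<forall>m'. mdvd m' m \<and> m' \<noteq> m \<longrightarrow> (monom m' :: 'k mpoly) \<notin> I)}"

definition support2 :: "nat \<Rightarrow> ('k::field) mpoly set \<Rightarrow> bool" where
  "support2 n I \<longleftrightarrow> (\<forall>m\<in>min_gens n I. \<exists>i j. i < j \<and> Poly_Mapping.keys m = {i, j})"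

definition underlying_edges :: "nat \<Rightarrow> ('k::field) mpoly set \<Rightarrow> nat set set" where
  "underlying_edges n I = Poly_Mapping.keys ` min_gens n I"

definition cycle_edges :: "nat \<Rightarrow> nat set set" where
  "cycle_edges n = {{i, Suc i mod n} | i. i < n}"

definition ideal_pow :: "nat \<Rightarrow> ('k::field) mpoly set \<Rightarrow> nat \<Rightarrow> 'k mpoly set" where
  "ideal_pow n I s = gen_ideal n {prod_list fs | fs. length fs = s \<and> set fs \<subseteq> I}"

definition radical :: "nat \<Rightarrow> ('k::field) mpoly set \<Rightarrow> 'k mpoly set" where
  "radical n I = {f \<in> polyring n. \<exists>k>0. f ^ k \<in> I}"

definition is_prime_ideal :: "nat \<Rightarrow> ('k::field) mpoly set \<Rightarrow> bool" where
  "is_prime_ideal n P \<longleftrightarrow> is_ideal n P \<and> 1 \<notin> P \<and>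
     (\<forall>f\<in>polyring n. \<forall>g\<in>polyring n. f * g \<in> P \<longrightarrow> f \<in> P \<or> g \<in> P)"

definition min_primes :: "nat \<Rightarrow> ('k::field) mpoly set \<Rightarrow> 'k mpoly set set" where
  "min_primes n I = {P. is_prime_ideal n P \<and> I \<subseteq> P \<and>
      (\<forall>Q. is_prime_ideal n Q \<and> I \<subseteq> Q \<and> Q \<subseteq> P \<longrightarrow> Q = P)}"

definition ass_primes :: "nat \<Rightarrow> ('k::field) mpoly set \<Rightarrow> 'k mpoly set set" where
  "ass_primes n I = {P. is_prime_ideal n P \<and>
      (\<exists>f\<in>polyring n. P = {g \<in> polyring n. g * f \<in> I})}"

definition has_embedded_prime :: "nat \<Rightarrow> ('k::field) mpoly set \<Rightarrow> bool" where
  "has_embedded_prime n I \<longleftrightarrow> (\<exists>P\<in>ass_primes n I. \<exists>Q\<in>ass_primes n I. Q \<subset> P)"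

text \<open>symbolic power: intersection over minimal primes P of I^s S_P \<inter> S\<close>
definition sym_pow :: "nat \<Rightarrow> ('k::field) mpoly set \<Rightarrow> nat \<Rightarrow> 'k mpoly set" where
  "sym_pow n I s = {f \<in> polyring n. \<forall>P\<in>min_primes n I.
      \<exists>g\<in>polyring n - P. g * f \<in> ideal_pow n I s}"

definition weight_mon :: "(nat \<Rightarrow> nat) \<Rightarrow> (nat \<Rightarrow>\<^sub>0 nat) \<Rightarrow> (nat \<Rightarrow>\<^sub>0 nat)" where
  "weight_mon d m = (\<Sum>i\<in>Poly_Mapping.keys m. Poly_Mapping.single i (d i * Poly_Mapping.lookup m i))"

definition weighted_ideal :: "nat \<Rightarrow> (nat \<Rightarrow> nat) \<Rightarrow> ('k::field) mpoly set \<Rightarrow> 'k mpoly set" where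
  "weighted_ideal n d J = gen_ideal n (monom ` weight_mon d ` min_gens n J)"

definition has_std_lin_weighting :: "nat \<Rightarrow> ('k::field) mpoly set \<Rightarrow> bool" where
  "has_std_lin_weighting n I \<longleftrightarrow>
     (\<exists>d. (\<forall>i<n. 0 < d i) \<and> I = weighted_ideal n d (radical n I))"

end

theory Submission
  imports Defs
begin

text \<open>
  If \<open>I\<close> is a weighted edge ideal, it is the intersection over the minimal vertex covers \<open>C\<close> of the
  irreducible ideals generated by \<open>x\<^sub>i\<close> raised to \<open>d i\<close> with \<open>i \<in> C\<close>, so its associated primes correspond to
  minimal vertex covers. Conversely, suppose that the generators on two edges \<open>uv\<close>, \<open>vw\<close> of the
  cycle have different exponents at \<open>v\<close>. For \<open>n \<ge> 6\<close> this yields a monomial outside \<open>I\<close> whose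
  colon ideal contains powers of three consecutive variables. An associated prime above that colon
  ideal belongs to a nonminimal vertex cover and is therefore embedded.

  For a weighted ideal, a monomial \<open>m\<close> lies in the \<open>s\<close>-th symbolic power iff the capacities
  \<open>m\<^sub>i div d i\<close> sum to at least \<open>s\<close> over every vertex cover, and in the \<open>s\<close>-th ordinary power iff
  there are \<open>s\<close> edges respecting these capacities. On an even, hence bipartite, cycle these
  conditions agree by a Koenig-type theorem; on an odd cycle all capacities equal to \<open>1\<close> with
  \<open>s = (n + 1) div 2\<close> separate them. Finally, equality for \<open>s = 1\<close> excludes embedded primes.
\<close>

abbreviation lookup where "lookup \<equiv> Poly_Mapping.lookup"
abbreviation keys where "keys \<equiv> Poly_Mapping.keys"
abbreviation single where "single \<equiv> Poly_Mapping.single"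

section \<open>Monomial ideals as sets of monomials\<close>

text \<open>Encodes an ideal that contains all terms of its elements by its set of monomials, so
  that membership and inclusion can be decided monomial by monomial.\<close>

definition mspan :: "(nat \<Rightarrow>\<^sub>0 nat) set \<Rightarrow> ('k::field) mpoly set" where
  "mspan A = {p. keys p \<subseteq> A}"

text \<open>The condition that makes \<open>mspan A\<close> an ideal of the polynomial ring in
  \<open>n\<close> variables.\<close>

definition upset :: "nat \<Rightarrow> (nat \<Rightarrow>\<^sub>0 nat) set \<Rightarrow> bool" where
  "upset n A \<longleftrightarrow> A \<subseteq> monomials n \<and> (\<forall>m\<in>A. \<forall>u\<in>monomials n. u + m \<in> A)"

definition upclosure :: "nat \<Rightarrow> (nat \<Rightarrow>\<^sub>0 nat) set \<Rightarrow> (nat \<Rightarrow>\<^sub>0 nat) set" where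
  "upclosure n G = {m \<in> monomials n. \<exists>g\<in>G. mdvd g m}"

text \<open>The monomials of the prime ideal generated by the variables with index in
  \<open>C\<close>; the empty set gives the zero ideal.\<close>

definition hits :: "nat \<Rightarrow> nat set \<Rightarrow> (nat \<Rightarrow>\<^sub>0 nat) set" where
  "hits n C = {m \<in> monomials n. keys m \<inter> C \<noteq> {}}"

lemma keys_add_nat: "keys (a + b :: 'a \<Rightarrow>\<^sub>0 nat) = keys a \<union> keys b"
  by (auto simp: in_keys_iff lookup_add)

lemma monomials_add: "a + b \<in> monomials n \<longleftrightarrow> a \<in> monomials n \<and> b \<in> monomials n"
  by (simp add: monomials_def keys_add_nat)

lemma zero_monomials: "0 \<in> monomials n"
  by (simp add: monomials_def)

lemma single_monomials: "i < n \<Longrightarrow> single i k \<in> monomials n"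
  by (simp add: monomials_def)

lemma lookup_monomials: "m \<in> monomials n \<Longrightarrow> n \<le> i \<Longrightarrow> lookup m i = 0"
  by (fastforce simp: monomials_def in_keys_iff)

lemma polyring_eq_mspan: "polyring n = mspan (monomials n)"
  by (auto simp: polyring_def mspan_def monomials_def)

lemma mspan_mono: "A \<subseteq> B \<Longrightarrow> mspan A \<subseteq> mspan B"
  by (auto simp: mspan_def)

lemma monom_in_mspan: "(monom m :: 'k::field mpoly) \<in> mspan A \<longleftrightarrow> m \<in> A"
  by (simp add: mspan_def monom_def)

lemma mspan_subset_iff: "(mspan A :: 'k::field mpoly set) \<subseteq> mspan B \<longleftrightarrow> A \<subseteq> B"
  using monom_in_mspan mspan_mono by blast

lemma mspan_inject: "(mspan A :: 'k::field mpoly set) = mspan B \<longleftrightarrow> A = B"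
  by (metis mspan_subset_iff subset_antisym order_refl)

lemma mdvd_iff_add: "mdvd a b \<longleftrightarrow> (\<exists>u. b = u + a)"
proof
  assume "mdvd a b"
  then have "b = (b - a) + a"
    by (intro poly_mapping_eqI) (simp add: lookup_add lookup_minus mdvd_def)
  then show "\<exists>u. b = u + a" ..
qed (auto simp: mdvd_def lookup_add)

lemma mdvd_trans: "mdvd a b \<Longrightarrow> mdvd b c \<Longrightarrow> mdvd a c"
  unfolding mdvd_def using order_trans by blast

lemma mdvd_refl: "mdvd a a"
  by (simp add: mdvd_def)

lemma mdvd_antisym: "mdvd a b \<Longrightarrow> mdvd b a \<Longrightarrow> a = b"
  by (intro poly_mapping_eqI) (simp add: mdvd_def order_antisym)

lemma mdvd_monomials: "mdvd a b \<Longrightarrow> b \<in> monomials n \<Longrightarrow> a \<in> monomials n"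
  by (auto simp: mdvd_iff_add monomials_add)

lemma upset_upclosure: "upset n (upclosure n G)"
  unfolding upset_def upclosure_def
  by (auto simp: monomials_add mdvd_def lookup_add intro: trans_le_add2)

lemma upclosureI: "g \<in> G \<Longrightarrow> mdvd g m \<Longrightarrow> m \<in> monomials n \<Longrightarrow> m \<in> upclosure n G"
  by (auto simp: upclosure_def)

lemma upset_hits: "upset n (hits n C)"
  unfolding upset_def hits_def by (auto simp: monomials_add keys_add_nat)

lemma upset_mult:
  assumes "upset n A" "keys p \<subseteq> monomials n" "keys q \<subseteq> A"
  shows "keys (p * q :: 'k::field mpoly) \<subseteq> A"
  using keys_mult[of p q] assms by (fastforce simp: upset_def)

lemma is_ideal_mspan:
  assumes "upset n A" shows "is_ideal n (mspan A :: 'k::field mpoly set)"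
proof -
  have "A \<subseteq> monomials n" using assms by (auto simp: upset_def)
  moreover have "f + g \<in> mspan A" if "f \<in> mspan A" "g \<in> mspan A" for f g :: "'k mpoly"
    using that keys_add[of f g] by (auto simp: mspan_def)
  moreover have "g * f \<in> mspan A" if "f \<in> mspan A" "g \<in> mspan (monomials n)" for f g :: "'k mpoly"
    using that upset_mult[OF assms, of g f] by (simp add: mspan_def)
  ultimately show ?thesis
    unfolding is_ideal_def polyring_eq_mspan by (auto simp: mspan_def)
qed

lemma poly_mapping_decomp: "p = (\<Sum>m\<in>keys p. single m (lookup p m))"
proof (rule poly_mapping_eqI)
  fix k
  have "(\<Sum>m\<in>keys p. lookup (single m (lookup p m)) k) = (\<Sum>m\<in>keys p. if m = k then lookup p k else 0)"
    by (intro sum.cong) (auto simp: lookup_single)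
  then show "lookup p k = lookup (\<Sum>m\<in>keys p. single m (lookup p m)) k"
    by (simp add: lookup_sum in_keys_iff)
qed

text \<open>A polynomial is the finite sum of its terms, and each term is a constant, written
  \<open>single 0 c\<close>, times a monomial of \<open>J\<close>.\<close>

lemma mspan_subset_ideal:
  fixes J :: "'k::field mpoly set"
  assumes J: "is_ideal n J" and "\<And>m. m \<in> A \<Longrightarrow> monom m \<in> J"
  shows "mspan A \<subseteq> J"
proof
  fix p :: "'k mpoly" assume p: "p \<in> mspan A"
  have t: "single m (lookup p m) \<in> J" if "m \<in> keys p" for m
  proof -
    have "monom m \<in> J" using that p assms(2) by (auto simp: mspan_def)
    moreover have "single 0 (lookup p m) \<in> polyring n"
      by (simp add: polyring_def)
    ultimately have "single 0 (lookup p m) * monom m \<in> J"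
      using J by (auto simp: is_ideal_def)
    then show ?thesis by (simp add: monom_def mult_single)
  qed
  have "(\<Sum>m\<in>K. single m (lookup p m)) \<in> J" if "finite K" "K \<subseteq> keys p" for K
    using that by (induction K) (use J t in \<open>auto simp: is_ideal_def\<close>)
  from this[of "keys p"] show "p \<in> J"
    using poly_mapping_decomp[of p] by simp
qed

lemma gen_ideal_eqI:
  assumes "is_ideal n J" "S \<subseteq> J" "\<And>K. is_ideal n K \<Longrightarrow> S \<subseteq> K \<Longrightarrow> J \<subseteq> K"
  shows "gen_ideal n S = J"
  unfolding gen_ideal_def using assms by blast

lemma monom_mult: "(monom a * monom b :: 'k::field mpoly) = monom (a + b)"
  by (simp add: monom_def mult_single)

lemma monom_in_ideal:
  fixes J :: "'k::field mpoly set"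
  assumes "is_ideal n J" "monom g \<in> J" "mdvd g m" "m \<in> monomials n"
  shows "monom m \<in> J"
proof -
  obtain u where u: "m = u + g" using assms by (auto simp: mdvd_iff_add)
  then have "(monom u :: 'k mpoly) \<in> polyring n"
    using assms by (simp add: polyring_eq_mspan monom_in_mspan monomials_add)
  then have "monom u * monom g \<in> J" using assms by (auto simp: is_ideal_def)
  then show ?thesis by (simp add: monom_mult u)
qed

lemma gen_ideal_monom:
  assumes "M \<subseteq> monomials n"
  shows "gen_ideal n (monom ` M) = (mspan (upclosure n M) :: 'k::field mpoly set)"
proof (rule gen_ideal_eqI)
  show "is_ideal n (mspan (upclosure n M) :: 'k mpoly set)"
    by (simp add: is_ideal_mspan upset_upclosure)
  show "monom ` M \<subseteq> (mspan (upclosure n M) :: 'k mpoly set)"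
  proof (rule image_subsetI)
    fix m assume "m \<in> M"
    then show "(monom m :: 'k mpoly) \<in> mspan (upclosure n M)"
      using assms upclosureI[OF _ mdvd_refl] by (auto simp: monom_in_mspan)
  qed
  show "mspan (upclosure n M) \<subseteq> K" if "is_ideal n K" "monom ` M \<subseteq> K" for K :: "'k mpoly set"
    using that by (intro mspan_subset_ideal) (auto simp: upclosure_def intro: monom_in_ideal)
qed

text \<open>A divisor of least total degree in \<open>A\<close> is minimal, since a proper divisor
  has smaller degree. Summing exponents over \<open>i < n\<close> loses nothing because divisors of
  \<open>m\<close> use only these variables.\<close>

lemma ex_minimal_divisor:
  assumes "m \<in> A" "m \<in> monomials n"
  shows "\<exists>g\<in>A. mdvd g m \<and> (\<forall>h. mdvd h g \<and> h \<noteq> g \<longrightarrow> h \<notin> A)"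
proof -
  let ?deg = "\<lambda>g. \<Sum>i<n. lookup g i"
  obtain g where g: "g \<in> A" "mdvd g m" "\<And>h. h \<in> A \<Longrightarrow> mdvd h m \<Longrightarrow> ?deg g \<le> ?deg h"
    using ex_has_least_nat[of "\<lambda>g. g \<in> A \<and> mdvd g m" m ?deg] assms mdvd_refl by blast
  have "h \<notin> A" if "mdvd h g" "h \<noteq> g" for h
  proof
    assume "h \<in> A"
    then have "?deg g \<le> ?deg h" using that g mdvd_trans by blast
    moreover have "\<exists>i. lookup h i \<noteq> lookup g i"
      using that by (meson poly_mapping_eqI)
    then obtain i where "lookup h i < lookup g i"
      using \<open>mdvd h g\<close> unfolding mdvd_def by (metis order_le_imp_less_or_eq)
    moreover have "g \<in> monomials n" using g assms mdvd_monomials by blast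
    ultimately have "i < n" "lookup h i < lookup g i"
      using lookup_monomials by (metis not_less not_less_zero)+
    then have "?deg h < ?deg g"
      using that by (intro sum_strict_mono_ex1) (auto simp: mdvd_def)
    then show False using \<open>?deg g \<le> ?deg h\<close> by simp
  qed
  then show ?thesis using g by blast
qed

text \<open>Every monomial of the ideal has a minimal divisor inside the ideal, so the minimal
  generators suffice even before their finiteness is known.\<close>

lemma monomial_ideal_eq_mspan_min_gens:
  fixes I :: "'k::field mpoly set"
  assumes "is_monomial_ideal n I"
  shows "I = mspan (upclosure n (min_gens n I))"
proof -
  obtain M where M: "M \<subseteq> monomials n" "I = gen_ideal n (monom ` M)"
    using assms by (auto simp: is_monomial_ideal_def)
  define A where "A = upclosure n M"
  have I: "I = mspan A" using M gen_ideal_monom A_def by auto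
  have G: "min_gens n I = {m \<in> A. \<forall>h. mdvd h m \<and> h \<noteq> m \<longrightarrow> h \<notin> A}"
    using upset_upclosure[of n M] by (auto simp: min_gens_def I monom_in_mspan A_def upclosure_def)
  have "upclosure n (min_gens n I) = A"
  proof
    show "upclosure n (min_gens n I) \<subseteq> A"
      unfolding G by (auto simp: upclosure_def A_def intro: mdvd_trans)
    show "A \<subseteq> upclosure n (min_gens n I)"
    proof
      fix m assume "m \<in> A"
      then have "m \<in> monomials n" by (simp add: A_def upclosure_def)
      then show "m \<in> upclosure n (min_gens n I)"
        using ex_minimal_divisor[OF \<open>m \<in> A\<close>] by (auto simp: G upclosure_def)
    qed
  qed
  then show ?thesis using I by simp
qed

section \<open>Primality of ideals generated by variables\<close>

text \<open>Keeps only the terms with monomials in \<open>K\<close>; it isolates the lowest-degree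
  parts in \<open>primary_cancel\<close>.\<close>

definition restr :: "'a set \<Rightarrow> ('a \<Rightarrow>\<^sub>0 'b::comm_monoid_add) \<Rightarrow> ('a \<Rightarrow>\<^sub>0 'b)" where
  "restr K p = (\<Sum>m\<in>keys p \<inter> K. single m (lookup p m))"

lemma lookup_restr: "lookup (restr K p) k = (if k \<in> K then lookup p k else 0)"
proof -
  have "lookup (restr K p) k = (\<Sum>m\<in>keys p \<inter> K. if m = k then lookup p k else 0)"
    unfolding restr_def lookup_sum by (intro sum.cong) (auto simp: lookup_single)
  then show ?thesis by (auto simp: in_keys_iff)
qed

lemma keys_restr: "keys (restr K p) = keys p \<inter> K"
  by (auto simp: in_keys_iff lookup_restr split: if_splits)

text \<open>Compare the parts of lowest degree in the variables of \<open>C\<close>.\<close>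
lemma primary_cancel:
  fixes p q :: "'k::field mpoly"
  assumes A: "upset n A"
    and inv: "\<And>u m. u \<in> monomials n \<Longrightarrow> keys u \<inter> C = {} \<Longrightarrow> m \<in> monomials n \<Longrightarrow> u + m \<in> A \<Longrightarrow> m \<in> A"
    and p: "p \<in> polyring n" "p \<notin> mspan (hits n C)" and q: "q \<in> polyring n"
    and pq: "p * q \<in> mspan A"
  shows "q \<in> mspan A"
proof (rule ccontr)
  assume "q \<notin> mspan A"
  define cdeg where "cdeg m = (\<Sum>i\<in>{..<n} \<inter> C. lookup m i)" for m :: "nat \<Rightarrow>\<^sub>0 nat"
  have cdeg_add: "cdeg (a + b) = cdeg a + cdeg b" for a b
    by (simp add: cdeg_def lookup_add sum.distrib)
  have km: "keys p \<subseteq> monomials n" "keys q \<subseteq> monomials n"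
    using p q by (auto simp: polyring_eq_mspan mspan_def)
  have "keys q - A \<noteq> {}" using \<open>q \<notin> mspan A\<close> by (auto simp: mspan_def)
  then obtain b0 where b0: "b0 \<in> keys q - A" "\<And>b. b \<in> keys q - A \<Longrightarrow> cdeg b0 \<le> cdeg b"
    using ex_has_least_nat[of "\<lambda>b. b \<in> keys q - A" _ cdeg] by blast
  \<comment> \<open>\<open>p1\<close> is the part of \<open>p\<close> free of \<open>C\<close>,
    nonzero because \<open>p\<close> lies outside the prime of \<open>C\<close>. \<open>q1\<close>
    is the part of least \<open>cdeg\<close> among the terms of \<open>q\<close> outside
    \<open>A\<close>.\<close>
  define p1 where "p1 = restr {m. keys m \<inter> C = {}} p"
  define q1 where "q1 = restr {m. m \<notin> A \<and> cdeg m = cdeg b0} q"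
  have "keys p1 \<noteq> {}"
    using p km by (auto simp: p1_def keys_restr mspan_def hits_def)
  then have "p1 \<noteq> 0" by auto
  moreover have "b0 \<in> keys q1" using b0 by (auto simp: q1_def keys_restr)
  then have "q1 \<noteq> 0" by auto
  ultimately have "keys (p1 * q1) \<noteq> {}" by simp
  then obtain k where k: "k \<in> keys (p1 * q1)" by blast
  then obtain a b where ab: "k = a + b" "a \<in> keys p1" "b \<in> keys q1"
    using keys_mult[of p1 q1] by blast
  have kA: "k \<notin> A"
    using ab inv[of a b] km by (auto simp: p1_def q1_def keys_restr)
  have ck: "cdeg k = cdeg b0"
  proof -
    have "cdeg a = 0" using ab by (auto simp: p1_def keys_restr cdeg_def in_keys_iff)
    then show ?thesis using ab by (simp add: cdeg_add q1_def keys_restr)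
  qed
  \<comment> \<open>The monomial \<open>k\<close> of \<open>p1 * q1\<close> gets no contribution
    from other pairs of terms: such a pair has its product in \<open>A\<close> or of
    \<open>cdeg\<close> above that of \<open>b0\<close>. Hence \<open>k\<close> survives in
    \<open>p * q\<close>.\<close>
  have high: "k \<noteq> a' + b'" if "a' \<in> keys p" "b' \<in> keys q" "cdeg a' > 0 \<or> b' \<notin> keys q1" for a' b'
  proof (cases "b' \<in> A")
    case True
    then show ?thesis using kA A that km by (auto simp: upset_def)
  next
    case False
    then have "cdeg b' \<ge> cdeg b0" using b0 that by blast
    moreover have "cdeg b' \<noteq> cdeg b0" if "b' \<notin> keys q1"
      using that False \<open>b' \<in> keys q\<close> by (auto simp: q1_def keys_restr)
    ultimately have "cdeg (a' + b') > cdeg b0" using that by (fastforce simp: cdeg_add)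
    then show ?thesis using ck by auto
  qed
  have keysp: "a' \<in> keys p \<and> cdeg a' > 0" if "a' \<in> keys (p - p1)" for a'
  proof -
    have *: "a' \<in> keys p" "keys a' \<inter> C \<noteq> {}"
      using that by (auto simp: in_keys_iff lookup_minus p1_def lookup_restr split: if_splits)
    then obtain i where i: "i \<in> keys a'" "i \<in> C" by blast
    then have "i < n" using * km by (auto simp: monomials_def)
    then show ?thesis using * i by (auto simp: cdeg_def in_keys_iff intro!: sum_pos2[of _ i])
  qed
  have keysq: "b' \<in> keys q \<and> b' \<notin> keys q1" if "b' \<in> keys (q - q1)" for b'
    using that by (auto simp: in_keys_iff lookup_minus q1_def lookup_restr split: if_splits)
  have "k \<notin> keys (p1 * (q - q1))"
    using high keysq keys_mult[of p1 "q - q1"] by (fastforce simp: p1_def keys_restr)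
  moreover have "k \<notin> keys ((p - p1) * q)"
    using high keysp keys_mult[of "p - p1" q] by fastforce
  moreover have "p * q = p1 * q1 + (p1 * (q - q1) + (p - p1) * q)"
    by (simp add: algebra_simps)
  ultimately have "lookup (p * q) k = lookup (p1 * q1) k"
    by (simp add: lookup_add in_keys_iff)
  then have "k \<in> keys (p * q)" using k by (simp add: in_keys_iff)
  then show False using pq kA by (auto simp: mspan_def)
qed

text \<open>This is \<open>primary_cancel\<close> for \<open>A = hits n C\<close>, since a factor
  free of \<open>C\<close> does not affect membership in \<open>hits n C\<close>.\<close>

lemma is_prime_hits: "is_prime_ideal n (mspan (hits n C) :: 'k::field mpoly set)"
  unfolding is_prime_ideal_def
proof (intro conjI ballI impI)
  show "is_ideal n (mspan (hits n C) :: 'k mpoly set)" by (simp add: is_ideal_mspan upset_hits)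
  show "(1 :: 'k mpoly) \<notin> mspan (hits n C)" by (simp add: mspan_def hits_def)
  fix f g :: "'k mpoly"
  assume "f \<in> polyring n" "g \<in> polyring n" "f * g \<in> mspan (hits n C)"
  then show "f \<in> mspan (hits n C) \<or> g \<in> mspan (hits n C)"
    using primary_cancel[OF upset_hits[of n C], of C f g] by (fastforce simp: hits_def keys_add_nat)
qed

text \<open>Recovers \<open>C\<close> from the prime generated by the variables in \<open>C\<close>.
  For an arbitrary prime it describes the largest prime of this kind inside it.\<close>

definition vars_in :: "nat \<Rightarrow> ('k::field) mpoly set \<Rightarrow> nat set" where
  "vars_in n P = {i. i < n \<and> monom (single i 1) \<in> P}"

lemma vars_in_hits: "C \<subseteq> {..<n} \<Longrightarrow> vars_in n (mspan (hits n C) :: 'k::field mpoly set) = C"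
  by (auto simp: vars_in_def monom_in_mspan hits_def single_monomials)

lemma hits_vars_in_subset:
  fixes P :: "'k::field mpoly set"
  assumes "is_ideal n P"
  shows "mspan (hits n (vars_in n P)) \<subseteq> P"
proof (rule mspan_subset_ideal[OF assms])
  fix m assume m: "m \<in> hits n (vars_in n P)"
  then obtain i where i: "i \<in> keys m" "monom (single i 1) \<in> P"
    by (auto simp: hits_def vars_in_def)
  then have "mdvd (single i 1) m" by (auto simp: mdvd_def lookup_single when_def in_keys_iff)
  then show "monom m \<in> P"
    using i m assms monom_in_ideal by (auto simp: hits_def)
qed

text \<open>Split one variable off \<open>m\<close>: by primality either that variable or the
  cofactor, of smaller degree, lies in \<open>P\<close>.\<close>

lemma prime_contains_variable:
  fixes P :: "'k::field mpoly set"
  assumes "is_prime_ideal n P" "m \<in> monomials n" "monom m \<in> P"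
  shows "keys m \<inter> vars_in n P \<noteq> {}"
  using assms(2,3)
proof (induction "\<Sum>i<n. lookup m i" arbitrary: m rule: less_induct)
  case less
  have "m \<noteq> 0"
    using less assms(1) by (auto simp: is_prime_ideal_def monom_def)
  then obtain i where i: "i \<in> keys m" by (metis keys_eq_empty all_not_in_conv)
  then have "i < n" using less by (auto simp: monomials_def)
  have m: "m = single i 1 + (m - single i 1)"
    using i by (intro poly_mapping_eqI) (auto simp: lookup_add lookup_minus lookup_single when_def in_keys_iff)
  define m' where "m' = m - single i 1"
  have m': "m = single i 1 + m'" using m m'_def by simp
  have mm: "m' \<in> monomials n" using less m' by (simp add: monomials_add)
  have "monom (single i 1) * monom m' \<in> P" using less m' by (simp add: monom_mult)
  then have "monom (single i 1) \<in> P \<or> monom m' \<in> P"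
    using assms(1) mm \<open>i < n\<close> unfolding is_prime_ideal_def polyring_eq_mspan
    by (meson monom_in_mspan single_monomials)
  then show ?case
  proof
    assume "monom (single i 1) \<in> P"
    then show ?thesis using i \<open>i < n\<close> by (auto simp: vars_in_def)
  next
    assume "monom m' \<in> P"
    moreover have "(\<Sum>i<n. lookup m' i) < (\<Sum>i<n. lookup m i)"
      using \<open>i < n\<close> by (intro sum_strict_mono_ex1) (auto simp: m' lookup_add lookup_single when_def)
    ultimately have "keys m' \<inter> vars_in n P \<noteq> {}" using less(1) mm by blast
    then show ?thesis by (auto simp: m' keys_add_nat)
  qed
qed

section \<open>Vertex covers, minimal primes and associated primes\<close>

definition cover :: "nat \<Rightarrow> nat set set \<Rightarrow> nat set \<Rightarrow> bool" where
  "cover n E C \<longleftrightarrow> C \<subseteq> {..<n} \<and> (\<forall>e\<in>E. e \<inter> C \<noteq> {})"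

definition min_cover :: "nat \<Rightarrow> nat set set \<Rightarrow> nat set \<Rightarrow> bool" where
  "min_cover n E C \<longleftrightarrow> cover n E C \<and> (\<forall>D. cover n E D \<and> D \<subseteq> C \<longrightarrow> D = C)"

lemma ex_min_cover:
  assumes "cover n E C" shows "\<exists>D\<subseteq>C. min_cover n E D"
proof -
  obtain D where D: "cover n E D" "D \<subseteq> C" "\<And>D'. cover n E D' \<Longrightarrow> D' \<subseteq> C \<Longrightarrow> card D \<le> card D'"
    using ex_has_least_nat[of "\<lambda>D. cover n E D \<and> D \<subseteq> C" C card] assms by blast
  have "D' = D" if "cover n E D'" "D' \<subseteq> D" for D'
    using D that by (meson card_seteq cover_def finite_lessThan finite_subset order_trans)
  then show ?thesis using D by (auto simp: min_cover_def)
qed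

lemma keys_mono: "mdvd a b \<Longrightarrow> keys a \<subseteq> keys b"
  by (auto simp: mdvd_iff_add keys_add_nat)

lemma upclosure_subset_hits:
  assumes "cover n (keys ` G) C" shows "upclosure n G \<subseteq> hits n C"
  using assms keys_mono by (fastforce simp: cover_def upclosure_def hits_def)

text \<open>Each generator lies in the prime, hence so does one of its variables. This is the
  passage from primes to vertex covers.\<close>

lemma cover_vars_in:
  fixes P :: "'k::field mpoly set"
  assumes "G \<subseteq> monomials n" "is_prime_ideal n P" "mspan (upclosure n G) \<subseteq> P"
  shows "cover n (keys ` G) (vars_in n P)"
  unfolding cover_def
proof (intro conjI ballI)
  show "vars_in n P \<subseteq> {..<n}" by (auto simp: vars_in_def)
  fix e assume "e \<in> keys ` G"
  then obtain g where g: "g \<in> G" "e = keys g" by blast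
  then have "(monom g :: 'k mpoly) \<in> mspan (upclosure n G)"
    using assms(1) upclosureI[OF g(1) mdvd_refl, of n] by (auto simp: monom_in_mspan)
  then have "monom g \<in> P" using assms(3) by blast
  then show "e \<inter> vars_in n P \<noteq> {}"
    using prime_contains_variable assms g by blast
qed

lemma hits_mono: "C \<subseteq> D \<Longrightarrow> hits n C \<subseteq> hits n D"
  by (auto simp: hits_def)

lemma prime_hits_subset_iff:
  assumes "C \<subseteq> {..<n}" "D \<subseteq> {..<n}"
  shows "(mspan (hits n C) :: 'k::field mpoly set) \<subseteq> mspan (hits n D) \<longleftrightarrow> C \<subseteq> D"
proof
  assume "(mspan (hits n C) :: 'k mpoly set) \<subseteq> mspan (hits n D)"
  then have "vars_in n (mspan (hits n C) :: 'k mpoly set) \<subseteq> vars_in n (mspan (hits n D) :: 'k mpoly set)"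
    by (auto simp: vars_in_def)
  then show "C \<subseteq> D" using assms by (simp add: vars_in_hits)
qed (simp add: mspan_mono hits_mono)

text \<open>The variables in a prime above the ideal form a cover, so the prime contains the prime
  of some minimal cover. Conversely, a prime above the ideal and inside that of a minimal cover
  \<open>C\<close> has its variables in \<open>C\<close>, and minimality forces equality.\<close>

lemma min_primes_eq:
  assumes "G \<subseteq> monomials n"
  shows "min_primes n (mspan (upclosure n G) :: 'k::field mpoly set) =
    (\<lambda>C. mspan (hits n C)) ` {C. min_cover n (keys ` G) C}"
proof (intro equalityI subsetI)
  fix P :: "'k mpoly set" assume P: "P \<in> min_primes n (mspan (upclosure n G))"
  then have *: "is_prime_ideal n P" "mspan (upclosure n G) \<subseteq> P" by (auto simp: min_primes_def)
  obtain C where C: "C \<subseteq> vars_in n P" "min_cover n (keys ` G) C"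
    using ex_min_cover[OF cover_vars_in[OF assms *]] by blast
  have "mspan (hits n C) \<subseteq> P"
    using hits_vars_in_subset[of n P] mspan_mono[OF hits_mono[OF C(1)]] * by (auto simp: is_prime_ideal_def)
  moreover have "mspan (upclosure n G) \<subseteq> (mspan (hits n C) :: 'k mpoly set)"
    using C by (intro mspan_mono upclosure_subset_hits) (auto simp: min_cover_def)
  ultimately have "mspan (hits n C) = P"
    using P is_prime_hits[of n C, where 'k='k] unfolding min_primes_def by blast
  then show "P \<in> (\<lambda>C. mspan (hits n C)) ` {C. min_cover n (keys ` G) C}" using C by auto
next
  fix P :: "'k mpoly set" assume "P \<in> (\<lambda>C. mspan (hits n C)) ` {C. min_cover n (keys ` G) C}"
  then obtain C where C: "P = mspan (hits n C)" "min_cover n (keys ` G) C" by blast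
  then have Cn: "C \<subseteq> {..<n}" by (auto simp: min_cover_def cover_def)
  have "Q = P" if Q: "is_prime_ideal n Q" "mspan (upclosure n G) \<subseteq> Q" "Q \<subseteq> P" for Q
  proof -
    have "vars_in n Q \<subseteq> C"
      using Q(3) vars_in_hits[OF Cn, where 'k='k] C by (auto simp: vars_in_def)
    then have "vars_in n Q = C"
      using C cover_vars_in[OF assms Q(1,2)] by (auto simp: min_cover_def)
    then have "P \<subseteq> Q" using hits_vars_in_subset[of n Q] C Q by (auto simp: is_prime_ideal_def)
    then show ?thesis using Q by simp
  qed
  then show "P \<in> min_primes n (mspan (upclosure n G))"
    using C is_prime_hits[of n C, where 'k='k] upclosure_subset_hits[of n G C]
    by (auto simp: min_primes_def min_cover_def mspan_subset_iff)
qed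

section \<open>Associated primes of monomial ideals and a criterion for embedded ones\<close>

lemma ass_primesD:
  fixes P :: "'k::field mpoly set"
  assumes "P \<in> ass_primes n I" "is_ideal n I"
  shows "is_prime_ideal n P" "I \<subseteq> P"
  using assms by (auto simp: ass_primes_def is_ideal_def mult.commute)

text \<open>Shifting exponents by \<open>g\<close> is injective, so no terms cancel; colon ideals by
  a monomial can therefore be computed on monomials.\<close>

lemma keys_mult_monom: "keys (p * monom g :: 'k::field mpoly) = (\<lambda>m. m + g) ` keys p"
proof -
  have "p * monom g = (\<Sum>m\<in>keys p. single (m + g) (lookup p m))"
    by (subst poly_mapping_decomp[of p]) (simp add: sum_distrib_right monom_def mult_single)
  then have l: "lookup (p * monom g) k = (\<Sum>m\<in>keys p. lookup p m when m + g = k)" for k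
    by (simp add: lookup_sum lookup_single)
  have "lookup (p * monom g) (m + g) = lookup p m" for m
    unfolding l by (simp add: when_def in_keys_iff)
  then show ?thesis
    using keys_mult[of p "monom g"] by (force simp: monom_def in_keys_iff)
qed

text \<open>Exponents beyond \<open>N\<close> never matter, so a multiple \<open>g\<close> of \<open>f\<close> outside the ideal whose
  truncated degree is maximal has a prime annihilator.\<close>
lemma ex_associated_prime:
  fixes f :: "nat \<Rightarrow>\<^sub>0 nat"
  assumes G: "G \<subseteq> monomials n" and N: "\<And>g i. g \<in> G \<Longrightarrow> lookup g i \<le> N"
    and f: "f \<in> monomials n" "f \<notin> upclosure n G"
  obtains C where "C \<subseteq> {..<n}" "mspan (hits n C) \<in> ass_primes n (mspan (upclosure n G) :: 'k::field mpoly set)"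
    "\<And>j k. j < n \<Longrightarrow> f + single j k \<in> upclosure n G \<Longrightarrow> j \<in> C"
    "\<And>j. N \<le> lookup f j \<Longrightarrow> j \<notin> C"
proof -
  define A where "A = upclosure n G"
  have up: "u + m \<in> A" if "m \<in> A" "u \<in> monomials n" for u m
    using upset_upclosure that by (auto simp: upset_def A_def)
  define tdeg where "tdeg g = (\<Sum>i<n. min N (lookup g i))" for g :: "nat \<Rightarrow>\<^sub>0 nat"
  let ?P = "\<lambda>g. g \<in> monomials n \<and> g \<notin> A \<and> mdvd f g"
  have "\<forall>g. ?P g \<longrightarrow> tdeg g < Suc (n * N)"
    using sum_bounded_above[of "{..<n}" "\<lambda>i. min N (lookup _ i)" N] by (simp add: tdeg_def less_Suc_eq_le)
  moreover have "?P f" using f mdvd_refl by (auto simp: A_def)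
  ultimately obtain g where g: "g \<in> monomials n" "g \<notin> A" "mdvd f g"
    and gmax: "\<And>h. ?P h \<Longrightarrow> tdeg h \<le> tdeg g"
    using ex_has_greatest_nat[of ?P f tdeg "Suc (n * N)"] by blast
  define C where "C = {i. i < n \<and> single i 1 + g \<in> A}"
  \<comment> \<open>If multiplying by the variable stays outside the ideal, maximality of the
    truncated degree means that its exponent has already reached \<open>N\<close>.\<close>
  have big: "N \<le> lookup g i" if "i < n" "i \<notin> C" for i
  proof (rule ccontr)
    assume "\<not> N \<le> lookup g i"
    then have "tdeg g < tdeg (single i 1 + g)"
      unfolding tdeg_def using \<open>i < n\<close>
      by (intro sum_strict_mono_ex1) (auto simp: lookup_add lookup_single when_def intro!: bexI[of _ i])
    moreover have "?P (single i 1 + g)"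
      using that g by (auto simp: C_def monomials_add single_monomials mdvd_def lookup_add intro: trans_le_add2)
    ultimately show False using gmax by fastforce
  qed
  \<comment> \<open>Raising exponents that are already at least \<open>N\<close> creates no new
    divisor in \<open>G\<close>, whose exponents are at most \<open>N\<close>.\<close>
  have notin: "u + g \<notin> A" if "\<And>i. i \<in> keys u \<Longrightarrow> N \<le> lookup g i" for u
  proof
    assume "u + g \<in> A"
    then obtain h where h: "h \<in> G" "mdvd h (u + g)" by (auto simp: A_def upclosure_def)
    have "lookup h i \<le> lookup g i" for i
    proof (cases "i \<in> keys u")
      case True then show ?thesis using that N[OF h(1), of i] by fastforce
    next
      case False
      then show ?thesis using h by (metis mdvd_def lookup_add in_keys_iff add_0)
    qed
    then show False using g h by (auto simp: A_def upclosure_def mdvd_def)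
  qed
  have colon: "u + g \<in> A \<longleftrightarrow> u \<in> hits n C" if "u \<in> monomials n" for u
  proof
    assume "u + g \<in> A"
    then obtain i where i: "i \<in> keys u" "\<not> N \<le> lookup g i" using notin by blast
    then have "i < n" using that by (auto simp: monomials_def)
    then show "u \<in> hits n C" using i big that by (auto simp: hits_def)
  next
    assume "u \<in> hits n C"
    then obtain i where i: "i \<in> keys u" "i \<in> C" by (auto simp: hits_def)
    then have "mdvd (single i 1) u" by (auto simp: mdvd_def lookup_single when_def in_keys_iff)
    then obtain v where v: "u = v + single i 1" by (auto simp: mdvd_iff_add)
    then have "v + (single i 1 + g) \<in> A" using i up that by (auto simp: C_def monomials_add)
    then show "u + g \<in> A" by (simp add: v add.assoc)
  qed
  have "mspan (hits n C) = {p \<in> polyring n. p * monom g \<in> (mspan A :: 'k mpoly set)}"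
    using colon by (fastforce simp: polyring_eq_mspan mspan_def keys_mult_monom hits_def)
  moreover have "(monom g :: 'k mpoly) \<in> polyring n"
    using g by (simp add: polyring_eq_mspan monom_in_mspan)
  ultimately have "mspan (hits n C) \<in> ass_primes n (mspan A :: 'k mpoly set)"
    using is_prime_hits unfolding ass_primes_def by blast
  moreover have "j \<in> C" if "j < n" "f + single j k \<in> A" for j k
  proof -
    obtain v where v: "g = v + f" using g by (auto simp: mdvd_iff_add)
    then have "v + (f + single j k) \<in> A" using up that g by (auto simp: monomials_add)
    then have "single j k + g \<in> A" by (simp add: v ac_simps)
    then have "single j k \<in> hits n C" using colon that by (simp add: single_monomials)
    then show ?thesis by (auto simp: hits_def split: if_splits)
  qed
  moreover have "j \<notin> C" if "N \<le> lookup f j" for j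
  proof -
    have "N \<le> lookup g j" using that g by (meson mdvd_def order_trans)
    then show ?thesis using notin[of "single j 1"] by (auto simp: C_def)
  qed
  ultimately show ?thesis
    using that[of C] by (auto simp: C_def A_def)
qed

text \<open>The associated prime obtained from \<open>f\<close> belongs to a cover \<open>C\<close>
  containing \<open>i\<close> and all its neighbours, so \<open>C - {i}\<close> is still a cover. A
  second associated prime is then found inside the prime of \<open>C - {i}\<close>.\<close>

lemma has_embedded_primeI:
  fixes f :: "nat \<Rightarrow>\<^sub>0 nat"
  assumes G: "G \<subseteq> monomials n" "finite G"
    and f: "f \<in> monomials n" "f \<notin> upclosure n G"
    and i: "i < n" "{i} \<notin> keys ` G"
    and pow: "\<And>e j. e \<in> keys ` G \<Longrightarrow> i \<in> e \<Longrightarrow> j \<in> e \<Longrightarrow> \<exists>k. f + single j k \<in> upclosure n G"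
    and powi: "\<exists>k. f + single i k \<in> upclosure n G"
  shows "has_embedded_prime n (mspan (upclosure n G) :: 'k::field mpoly set)"
proof -
  have "\<exists>N. \<forall>g\<in>G. \<forall>i. lookup g i \<le> N"
  proof -
    have "lookup g i \<le> (\<Sum>g\<in>G. \<Sum>i\<in>keys g. lookup g i)" if "g \<in> G" for g i
    proof (cases "i \<in> keys g")
      case True
      then have "lookup g i \<le> (\<Sum>i\<in>keys g. lookup g i)" by (intro member_le_sum) auto
      also have "\<dots> \<le> (\<Sum>g\<in>G. \<Sum>i\<in>keys g. lookup g i)"
        using that G by (intro member_le_sum) auto
      finally show ?thesis .
    qed (simp add: in_keys_iff)
    then show ?thesis by blast
  qed
  then obtain N where N: "\<And>g i. g \<in> G \<Longrightarrow> lookup g i \<le> N" by blast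
  obtain C where C: "C \<subseteq> {..<n}" "mspan (hits n C) \<in> ass_primes n (mspan (upclosure n G) :: 'k mpoly set)"
    "\<And>j k. j < n \<Longrightarrow> f + single j k \<in> upclosure n G \<Longrightarrow> j \<in> C"
    using ex_associated_prime[OF G(1) N f, where 'k='k] by metis
  \<comment> \<open>The support of \<open>f0\<close> misses the cover \<open>C - {i}\<close>, so
    \<open>f0\<close> lies outside the ideal. Its exponents \<open>N\<close> elsewhere confine the
    second variable set \<open>D\<close> to \<open>C - {i}\<close>.\<close>
  define f0 where "f0 = (\<Sum>j\<in>{..<n} - (C - {i}). single j N)"
  have lf0: "lookup f0 j = (if j \<in> {..<n} - (C - {i}) then N else 0)" for j
    by (auto simp: f0_def lookup_sum lookup_single when_def)
  have f0n: "f0 \<in> monomials n"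
    by (auto simp: monomials_def in_keys_iff lf0 split: if_splits)
  have "cover n (keys ` G) C"
    using cover_vars_in[OF G(1) ass_primesD[OF C(2)]] C(1)
    by (simp add: vars_in_hits is_ideal_mspan upset_upclosure)
  have "f0 \<notin> upclosure n G"
  proof
    assume "f0 \<in> upclosure n G"
    then obtain h where h: "h \<in> G" "keys h \<subseteq> keys f0"
      using keys_mono by (auto simp: upclosure_def)
    then have "keys h \<inter> (C - {i}) = {}" by (auto simp: in_keys_iff lf0 split: if_splits)
    moreover have "keys h \<inter> C \<noteq> {}" using \<open>cover n (keys ` G) C\<close> h by (auto simp: cover_def)
    ultimately have "i \<in> keys h" by blast
    moreover have "keys h \<noteq> {i}" using h i by blast
    ultimately obtain j where j: "j \<in> keys h" "j \<noteq> i" by blast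
    then have "j < n" using h G by (auto simp: monomials_def)
    then have "j \<in> C" using pow[of "keys h" j] h j \<open>i \<in> keys h\<close> C(3) by blast
    then show False using j \<open>keys h \<inter> (C - {i}) = {}\<close> by blast
  qed
  then obtain D where D: "D \<subseteq> {..<n}" "mspan (hits n D) \<in> ass_primes n (mspan (upclosure n G) :: 'k mpoly set)"
    "\<And>j. N \<le> lookup f0 j \<Longrightarrow> j \<notin> D"
    using ex_associated_prime[OF G(1) N f0n, where 'k='k] by metis
  have "D \<subseteq> C - {i}"
  proof
    fix j assume "j \<in> D"
    then have "j < n" "\<not> N \<le> lookup f0 j" using D by auto
    then show "j \<in> C - {i}" by (simp add: lf0 split: if_splits)
  qed
  moreover have "i \<in> C" using powi C(3) i by blast
  ultimately have "(mspan (hits n D) :: 'k mpoly set) \<subset> mspan (hits n C)"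
    using prime_hits_subset_iff[OF D(1) C(1), where 'k='k] prime_hits_subset_iff[OF C(1) D(1), where 'k='k]
    by blast
  then show ?thesis using C D unfolding has_embedded_prime_def by blast
qed

section \<open>A capacitated Koenig theorem\<close>

text \<open>An edge \<open>{u, v}\<close> lying in no cover of weight exactly \<open>s\<close> can be removed, lowering the
  capacities of its ends by one. Such an edge exists at any suitable \<open>u\<close>: the covers of minimum
  weight containing \<open>u\<close> are closed under intersection inside \<open>L\<close> and union outside \<open>L\<close>, so there is
  one whose part outside \<open>L\<close> is largest, and it misses a neighbour \<open>v\<close> of \<open>u\<close>.\<close>
lemma bipartite_capacitated_matching:
  fixes c :: "'a \<Rightarrow> nat"
  assumes V: "finite V"
    and E: "\<And>e. e \<in> E \<Longrightarrow> \<exists>a b. e = {a, b} \<and> a \<in> V \<and> b \<in> V \<and> a \<in> L \<and> b \<notin> L"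
    and "\<And>C. C \<subseteq> V \<Longrightarrow> (\<forall>e\<in>E. e \<inter> C \<noteq> {}) \<Longrightarrow> s \<le> sum c C"
  shows "\<exists>es. length es = s \<and> set es \<subseteq> E \<and> (\<forall>v. length (filter (\<lambda>e. v \<in> e) es) \<le> c v)"
  using assms(3)
proof (induction s arbitrary: c)
  case 0
  show ?case by (intro exI[of _ "[]"]) simp
next
  case (Suc s)
  define cov where "cov C \<longleftrightarrow> C \<subseteq> V \<and> (\<forall>e\<in>E. e \<inter> C \<noteq> {})" for C
  have cov: "Suc s \<le> sum c C" if "cov C" for C using Suc.prems that by (simp add: cov_def)
  have sumV: "sum c C = (\<Sum>v\<in>V. if v \<in> C then c v else 0)" if "C \<subseteq> V" for C
    using that V by (metis sum.inter_restrict inf.absorb_iff2)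
  \<comment> \<open>Vertices of capacity zero have total weight below \<open>Suc s\<close>, so they
    do not form a cover; an edge they miss has positive capacity at both ends.\<close>
  define Z where "Z = {v \<in> V. c v = 0}"
  have sZ: "sum c Z = 0" by (simp add: Z_def)
  then have "\<not> cov Z" using cov by fastforce
  then obtain e0 where "e0 \<in> E" "e0 \<inter> Z = {}" by (auto simp: cov_def Z_def)
  moreover obtain u v0 where "e0 = {u, v0}" "u \<in> V" "v0 \<in> V" "u \<in> L" "v0 \<notin> L"
    using E \<open>e0 \<in> E\<close> by blast
  ultimately have u: "{u, v0} \<in> E" "u \<in> V" "v0 \<in> V" "u \<in> L" "v0 \<notin> L" "c u > 0" "c v0 > 0"
    by (auto simp: Z_def)
  define tight where "tight C \<longleftrightarrow> cov C \<and> u \<in> C \<and> sum c C = Suc s" for C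
  have "\<exists>v. {u, v} \<in> E \<and> v \<in> V \<and> v \<notin> L \<and> c v > 0 \<and> (\<forall>C. tight C \<longrightarrow> v \<notin> C)"
  proof (cases "\<exists>C. tight C")
    case False
    then show ?thesis using u by blast
  next
    case True
    then obtain C0 where "tight C0" ..
    moreover have "\<forall>C. tight C \<longrightarrow> card (C - L) < Suc (card V)"
      using V by (auto simp: tight_def cov_def less_Suc_eq_le intro!: card_mono)
    ultimately obtain C1 where C1: "tight C1" "\<And>C. tight C \<Longrightarrow> card (C - L) \<le> card (C1 - L)"
      using ex_has_greatest_nat[of tight C0 "\<lambda>C. card (C - L)" "Suc (card V)"] by blast
    have C1V: "C1 \<subseteq> V" "u \<in> C1" "finite C1" using C1 V by (auto simp: tight_def cov_def intro: finite_subset)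
    have "\<exists>v. {u, v} \<in> E \<and> v \<in> V \<and> v \<notin> L \<and> c v > 0 \<and> v \<notin> C1"
    proof (rule ccontr)
      assume no: "\<not> ?thesis"
      \<comment> \<open>If \<open>C1\<close> contained every neighbour of \<open>u\<close> of
        positive capacity, \<open>u\<close> could be traded for \<open>Z\<close>, giving a cover of
        weight below \<open>Suc s\<close>.\<close>
      define D where "D = (C1 - {u}) \<union> Z"
      have "e \<inter> D \<noteq> {}" if e: "e \<in> E" for e
      proof -
        obtain a b where ab: "e = {a, b}" "a \<in> V" "b \<in> V" "a \<in> L" "b \<notin> L" using E e by blast
        show ?thesis
        proof (cases "a = u")
          case True
          then show ?thesis using ab no that u by (auto simp: D_def Z_def)
        next
          case False
          moreover have "b \<noteq> u" using ab u by auto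
          moreover have "e \<inter> C1 \<noteq> {}" using C1 that by (auto simp: tight_def cov_def)
          ultimately show ?thesis using ab by (auto simp: D_def)
        qed
      qed
      then have "cov D" using C1V by (auto simp: cov_def D_def Z_def)
      then have "Suc s \<le> sum c D" using cov by blast
      also have "\<dots> \<le> sum c (C1 - {u}) + sum c Z"
        unfolding D_def using C1V V by (subst sum.union_inter[symmetric]) (auto simp: Z_def)
      also have "\<dots> < sum c C1"
        using C1V u by (simp add: sZ sum.remove[of C1 u])
      finally show False using C1 by (simp add: tight_def)
    qed
    then obtain v where v: "{u, v} \<in> E" "v \<in> V" "v \<notin> L" "c v > 0" "v \<notin> C1" by blast
    have "v \<notin> C" if "tight C" for C
    proof
      assume "v \<in> C"
      \<comment> \<open>Uncrossing: \<open>C2\<close> and \<open>C3\<close> are covers whose weights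
        add up to those of \<open>C1\<close> and \<open>C\<close>. As each weighs at least
        \<open>Suc s\<close>, \<open>C2\<close> is tight, and it has the additional vertex
        \<open>v\<close> outside \<open>L\<close>.\<close>
      define C2 where "C2 = (C1 \<inter> C \<inter> L) \<union> ((C1 \<union> C) - L)"
      define C3 where "C3 = ((C1 \<union> C) \<inter> L) \<union> (C1 \<inter> C - L)"
      have CV: "C \<subseteq> V" using that by (auto simp: tight_def cov_def)
      have sub: "C2 \<subseteq> V" "C3 \<subseteq> V" using CV C1V by (auto simp: C2_def C3_def)
      have "e \<inter> C2 \<noteq> {} \<and> e \<inter> C3 \<noteq> {}" if e: "e \<in> E" for e
      proof -
        obtain a b where ab: "e = {a, b}" "a \<in> L" "b \<notin> L" using E e by blast
        moreover have "e \<inter> C1 \<noteq> {}" "e \<inter> C \<noteq> {}"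
          using C1 \<open>tight C\<close> that by (auto simp: tight_def cov_def)
        ultimately show ?thesis by (auto simp: C2_def C3_def)
      qed
      then have "cov C2" "cov C3" using sub by (auto simp: cov_def)
      moreover have "sum c C2 + sum c C3 = sum c C1 + sum c C"
        unfolding sumV[OF sub(1)] sumV[OF sub(2)] sumV[OF C1V(1)] sumV[OF CV] sum.distrib[symmetric]
        by (intro sum.cong) (auto simp: C2_def C3_def)
      moreover have "sum c C1 = Suc s" "sum c C = Suc s" using C1 that by (auto simp: tight_def)
      ultimately have "sum c C2 = Suc s" using cov[of C2] cov[of C3] by linarith
      then have "tight C2"
        using \<open>cov C2\<close> that C1V u by (auto simp: tight_def C2_def)
      then have "card (C2 - L) \<le> card (C1 - L)" using C1 by blast
      moreover have "C1 - L \<subset> C2 - L" using v \<open>v \<in> C\<close> by (auto simp: C2_def)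
      then have "card (C1 - L) < card (C2 - L)"
        using V sub by (meson finite_Diff finite_subset psubset_card_mono)
      ultimately show False by simp
    qed
    then show ?thesis using v by blast
  qed
  then obtain v where v: "{u, v} \<in> E" "v \<in> V" "v \<notin> L" "c v > 0" "\<And>C. tight C \<Longrightarrow> v \<notin> C" by blast
  have "u \<noteq> v" using u v by auto
  define c' where "c' = (\<lambda>x. c x - (if x = u then 1 else 0) - (if x = v then 1 else 0))"
  have cc': "c x = c' x + (if x = u then 1 else 0) + (if x = v then 1 else 0)" for x
    using u v \<open>u \<noteq> v\<close> by (auto simp: c'_def)
  \<comment> \<open>A cover with at most one of \<open>u\<close>, \<open>v\<close> loses at most one
    unit. A cover with both is not tight, so it had weight at least \<open>s + 2\<close>.\<close>
  have "s \<le> sum c' C" if "C \<subseteq> V" "\<forall>e\<in>E. e \<inter> C \<noteq> {}" for C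
  proof -
    have C: "cov C" "finite C" using that V by (auto simp: cov_def intro: finite_subset)
    have "sum c C = sum c' C + (if u \<in> C then 1 else 0) + (if v \<in> C then 1 else 0)"
      unfolding cc' using C(2) by (simp add: sum.distrib)
    moreover have "sum c C \<noteq> Suc s" if "u \<in> C" "v \<in> C"
      using v(5) that C by (auto simp: tight_def)
    ultimately show ?thesis using cov[OF C(1)] by (auto split: if_splits)
  qed
  then obtain es where es: "length es = s" "set es \<subseteq> E" "\<And>w. length (filter (\<lambda>e. w \<in> e) es) \<le> c' w"
    using Suc.IH[of c'] by blast
  show ?case
  proof (intro exI[of _ "{u, v} # es"] conjI allI)
    fix w
    show "length (filter (\<lambda>e. w \<in> e) ({u, v} # es)) \<le> c w"
      using es(3)[of w] cc'[of w] by auto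
  qed (use es v in auto)
qed

section \<open>Powers of monomial ideals\<close>

lemma monomials_sum_list: "set gs \<subseteq> monomials n \<Longrightarrow> sum_list gs \<in> monomials n"
  by (induction gs) (auto simp: monomials_add zero_monomials)

lemma mdvd_add: "mdvd a b \<Longrightarrow> mdvd c d \<Longrightarrow> mdvd (a + c) (b + d)"
  by (simp add: mdvd_def lookup_add add_mono)

lemma prod_list_monom: "prod_list (map monom gs) = (monom (sum_list gs) :: 'k::field mpoly)"
  by (induction gs) (simp_all add: monom_mult, simp add: monom_def)

text \<open>A monomial of a product of \<open>s\<close> elements is a product of \<open>s\<close>
  monomials, each divisible by a generator. Products of generators appear as sums of exponent
  vectors.\<close>

lemma ideal_pow_mspan:
  assumes "G \<subseteq> monomials n"
  shows "ideal_pow n (mspan (upclosure n G) :: 'k::field mpoly set) s =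
    mspan (upclosure n {sum_list gs | gs. length gs = s \<and> set gs \<subseteq> G})"
  unfolding ideal_pow_def
proof (rule gen_ideal_eqI)
  let ?S = "\<lambda>s. {sum_list gs | gs. length gs = s \<and> set gs \<subseteq> G}"
  show "is_ideal n (mspan (upclosure n (?S s)) :: 'k mpoly set)"
    by (simp add: is_ideal_mspan upset_upclosure)
  have "keys (prod_list fs) \<subseteq> upclosure n (?S (length fs))"
    if "set fs \<subseteq> (mspan (upclosure n G) :: 'k mpoly set)" for fs
    using that
  proof (induction fs)
    case Nil
    show ?case by (simp add: upclosure_def zero_monomials mdvd_refl)
  next
    case (Cons f fs)
    show ?case
    proof
      fix m assume "m \<in> keys (prod_list (f # fs))"
      then obtain a b where ab: "m = a + b" "a \<in> keys f" "b \<in> keys (prod_list fs)"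
        using keys_mult[of f "prod_list fs"] by auto
      have "a \<in> upclosure n G" using ab Cons.prems by (auto simp: mspan_def)
      then obtain g where g: "g \<in> G" "mdvd g a" "a \<in> monomials n" by (auto simp: upclosure_def)
      have "b \<in> upclosure n (?S (length fs))" using ab Cons by auto
      then obtain gs where gs: "length gs = length fs" "set gs \<subseteq> G" "mdvd (sum_list gs) b" "b \<in> monomials n"
        by (auto simp: upclosure_def)
      have "sum_list (g # gs) \<in> ?S (length (f # fs))"
        using g gs by (intro CollectI exI[of _ "g # gs"]) simp
      moreover have "mdvd (sum_list (g # gs)) m" using g gs ab by (simp add: mdvd_add)
      ultimately show "m \<in> upclosure n (?S (length (f # fs)))"
        using ab g gs by (intro upclosureI) (auto simp: monomials_add)
    qed
  qed
  then show "{prod_list fs | fs. length fs = s \<and> set fs \<subseteq> mspan (upclosure n G)}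
      \<subseteq> (mspan (upclosure n (?S s)) :: 'k mpoly set)"
    unfolding mspan_def by blast
  fix K :: "'k mpoly set"
  assume K: "is_ideal n K" "{prod_list fs | fs. length fs = s \<and> set fs \<subseteq> mspan (upclosure n G)} \<subseteq> K"
  show "mspan (upclosure n (?S s)) \<subseteq> K"
  proof (rule mspan_subset_ideal[OF K(1)])
    fix m assume "m \<in> upclosure n (?S s)"
    then obtain gs where gs: "length gs = s" "set gs \<subseteq> G" "mdvd (sum_list gs) m" "m \<in> monomials n"
      by (auto simp: upclosure_def)
    have "set (map monom gs) \<subseteq> (mspan (upclosure n G) :: 'k mpoly set)"
    proof
      fix x :: "'k mpoly" assume "x \<in> set (map monom gs)"
      then obtain g where "g \<in> G" "x = monom g" using gs by auto
      then show "x \<in> mspan (upclosure n G)"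
        using assms upclosureI[OF _ mdvd_refl, of g G n] by (auto simp: monom_in_mspan)
    qed
    then have "prod_list (map monom gs) \<in> K"
      using gs by (intro subsetD[OF K(2)] CollectI exI[of _ "map monom gs"]) simp
    then show "monom m \<in> K"
      using K gs monom_in_ideal by (auto simp: prod_list_monom)
  qed
qed

section \<open>Weighted edge ideals\<close>

text \<open>With \<open>d\<close> constantly 1 this is the squarefree monomial with support
  \<open>e\<close>; general \<open>d\<close> gives its image under the weighting.\<close>

definition wgen :: "(nat \<Rightarrow> nat) \<Rightarrow> nat set \<Rightarrow> (nat \<Rightarrow>\<^sub>0 nat)" where
  "wgen d e = (\<Sum>i\<in>e. single i (d i))"

lemma lookup_wgen: "finite e \<Longrightarrow> lookup (wgen d e) i = (if i \<in> e then d i else 0)"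
  by (auto simp: wgen_def lookup_sum lookup_single when_def)

lemma keys_wgen_subset: "finite e \<Longrightarrow> keys (wgen d e) \<subseteq> e"
  by (rule subsetI) (simp add: in_keys_iff lookup_wgen split: if_splits)

lemma keys_wgen: "finite e \<Longrightarrow> (\<And>i. i \<in> e \<Longrightarrow> 0 < d i) \<Longrightarrow> keys (wgen d e) = e"
  by (auto simp: in_keys_iff lookup_wgen split: if_splits)

section \<open>Radicals and the weighting condition in terms of generators\<close>

lemma lookup_pos_of_keys_subset: "keys g \<subseteq> keys m \<Longrightarrow> i \<in> keys g \<Longrightarrow> 0 < lookup (m :: nat \<Rightarrow>\<^sub>0 nat) i"
  by (auto simp: in_keys_iff)

lemma lookup_sum_list_replicate: "lookup (sum_list (replicate k m)) i = k * lookup (m :: nat \<Rightarrow>\<^sub>0 nat) i"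
  by (induction k) (auto simp: lookup_add)

lemma monom_power: "(monom m :: 'k::field mpoly) ^ k = monom (sum_list (replicate k m))"
  using prod_list_monom[of "replicate k m", where 'k='k] by (induction k) auto

text \<open>Only supports matter: once the support of \<open>g\<close> lies in that of
  \<open>m\<close>, a power of \<open>m\<close> exceeding all exponents of \<open>g\<close> is
  divisible by \<open>g\<close>.\<close>

lemma monom_in_radical:
  assumes "G \<subseteq> monomials n"
  shows "(monom m :: 'k::field mpoly) \<in> radical n (mspan (upclosure n G)) \<longleftrightarrow>
    m \<in> monomials n \<and> (\<exists>g\<in>G. keys g \<subseteq> keys m)"
proof
  assume "(monom m :: 'k mpoly) \<in> radical n (mspan (upclosure n G))"
  then obtain k where k: "m \<in> monomials n" "sum_list (replicate k m) \<in> upclosure n G"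
    by (auto simp: radical_def polyring_eq_mspan monom_in_mspan monom_power)
  then obtain g where g: "g \<in> G" "mdvd g (sum_list (replicate k m))" by (auto simp: upclosure_def)
  have "keys g \<subseteq> keys m"
  proof
    fix i assume i: "i \<in> keys g"
    have "lookup g i \<le> k * lookup m i" using g by (simp add: mdvd_def lookup_sum_list_replicate)
    then show "i \<in> keys m" using i by (cases "lookup m i = 0") (auto simp: in_keys_iff)
  qed
  then show "m \<in> monomials n \<and> (\<exists>g\<in>G. keys g \<subseteq> keys m)" using k g by blast
next
  assume "m \<in> monomials n \<and> (\<exists>g\<in>G. keys g \<subseteq> keys m)"
  then obtain g where g: "m \<in> monomials n" "g \<in> G" "keys g \<subseteq> keys m" by blast
  define k where "k = Suc (\<Sum>i\<in>keys g. lookup g i)"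
  have "lookup g i \<le> k * lookup m i" for i
  proof (cases "i \<in> keys g")
    case True
    then have "lookup g i \<le> (\<Sum>i\<in>keys g. lookup g i)" by (intro member_le_sum) auto
    then have "lookup g i \<le> k * 1" by (simp add: k_def)
    also have "\<dots> \<le> k * lookup m i" using lookup_pos_of_keys_subset[OF g(3) True] by (intro mult_le_mono2) simp
    finally show ?thesis .
  qed (simp add: in_keys_iff)
  then have "mdvd g (sum_list (replicate k m))" by (simp add: mdvd_def lookup_sum_list_replicate)
  moreover have "sum_list (replicate k m) \<in> monomials n"
    using g by (intro monomials_sum_list) auto
  ultimately have "(monom m :: 'k mpoly) ^ k \<in> mspan (upclosure n G)"
    using g by (simp add: monom_power monom_in_mspan upclosureI)
  then show "(monom m :: 'k mpoly) \<in> radical n (mspan (upclosure n G))"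
    using g unfolding radical_def by (auto simp: k_def polyring_eq_mspan monom_in_mspan)
qed

text \<open>The squarefree monomials on the supports of \<open>G\<close> generate the monomials of
  the radical, and none is redundant because the supports form an antichain.\<close>

lemma min_gens_radical:
  assumes G: "G \<subseteq> monomials n"
    and antichain: "\<And>g h. g \<in> G \<Longrightarrow> h \<in> G \<Longrightarrow> keys g \<subseteq> keys h \<Longrightarrow> keys g = keys h"
  shows "min_gens n (radical n (mspan (upclosure n G)) :: 'k::field mpoly set) = wgen (\<lambda>_. 1) ` keys ` G"
proof (intro equalityI subsetI)
  fix m assume "m \<in> min_gens n (radical n (mspan (upclosure n G)) :: 'k mpoly set)"
  then obtain g where g: "m \<in> monomials n" "g \<in> G" "keys g \<subseteq> keys m"
    and min: "\<And>m'. mdvd m' m \<Longrightarrow> m' \<noteq> m \<Longrightarrow> \<not> (m' \<in> monomials n \<and> (\<exists>g\<in>G. keys g \<subseteq> keys m'))"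
    by (auto simp: min_gens_def monom_in_radical[OF G])
  let ?w = "wgen (\<lambda>_. 1) (keys g)"
  have "keys ?w = keys g" by (simp add: keys_wgen)
  moreover have "mdvd ?w m"
    using lookup_pos_of_keys_subset[OF g(3)] by (auto simp: mdvd_def lookup_wgen Suc_le_eq)
  moreover have "?w \<in> monomials n" using \<open>keys ?w = keys g\<close> g G by (auto simp: monomials_def)
  ultimately have "?w = m" using min[of ?w] g by blast
  then show "m \<in> wgen (\<lambda>_. 1) ` keys ` G" using g by blast
next
  fix m assume "m \<in> wgen (\<lambda>_. 1) ` keys ` G"
  then obtain g where g: "g \<in> G" "m = wgen (\<lambda>_. 1) (keys g)" by blast
  then have km: "keys m = keys g" by (simp add: keys_wgen)
  have "m' = m" if "mdvd m' m" "h \<in> G" "keys h \<subseteq> keys m'" for m' h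
  proof -
    have "keys m' \<subseteq> keys m" using that by (auto simp: mdvd_iff_add keys_add_nat)
    then have "keys m' = keys m" using antichain[of h g] that g km by auto
    then have "mdvd m m'"
      using g km lookup_pos_of_keys_subset[of m m'] by (auto simp: mdvd_def lookup_wgen Suc_le_eq)
    then show ?thesis using that mdvd_antisym by blast
  qed
  moreover have "m \<in> monomials n" using km g G by (auto simp: monomials_def)
  ultimately show "m \<in> min_gens n (radical n (mspan (upclosure n G)) :: 'k mpoly set)"
    using g km by (auto simp: min_gens_def monom_in_radical[OF G])
qed

lemma weight_mon_wgen: "finite e \<Longrightarrow> weight_mon d (wgen (\<lambda>_. 1) e) = wgen d e"
  unfolding weight_mon_def by (subst keys_wgen) (auto simp: wgen_def[of d] lookup_wgen intro!: sum.cong)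

lemma has_std_lin_weighting_iff:
  assumes G: "G \<subseteq> monomials n"
    and antichain: "\<And>g h. g \<in> G \<Longrightarrow> h \<in> G \<Longrightarrow> keys g \<subseteq> keys h \<Longrightarrow> keys g = keys h"
  shows "has_std_lin_weighting n (mspan (upclosure n G) :: 'k::field mpoly set) \<longleftrightarrow>
    (\<exists>d. (\<forall>i<n. 0 < d i) \<and> upclosure n G = upclosure n (wgen d ` keys ` G))"
proof -
  have "weighted_ideal n d (radical n (mspan (upclosure n G)) :: 'k mpoly set) =
      mspan (upclosure n (wgen d ` keys ` G))" for d
  proof -
    have "weight_mon d ` wgen (\<lambda>_. 1) ` keys ` G = wgen d ` keys ` G"
      unfolding image_image by (intro image_cong refl weight_mon_wgen finite_keys)
    moreover have "wgen d ` keys ` G \<subseteq> monomials n"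
    proof (unfold image_image, rule image_subsetI)
      fix g assume "g \<in> G"
      moreover have "keys (wgen d (keys g)) \<subseteq> keys g"
        by (simp add: keys_wgen_subset)
      ultimately show "wgen d (keys g) \<in> monomials n" using G by (auto simp: monomials_def)
    qed
    moreover have "min_gens n (radical n (mspan (upclosure n G)) :: 'k mpoly set) = wgen (\<lambda>_. 1) ` keys ` G"
      using assms by (rule min_gens_radical)
    ultimately show ?thesis
      unfolding weighted_ideal_def by (simp only: gen_ideal_monom)
  qed
  then show ?thesis by (simp add: has_std_lin_weighting_def mspan_inject)
qed

section \<open>Associated primes of weighted edge ideals\<close>

lemma weighted_gens:
  assumes "\<And>e. e \<in> E \<Longrightarrow> e \<subseteq> {..<n}" "\<And>i. i < n \<Longrightarrow> 0 < d i"
  shows "keys ` wgen d ` E = E" "wgen d ` E \<subseteq> monomials n"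
proof -
  have k: "keys (wgen d e) = e" if "e \<in> E" for e
    using assms(1)[OF that] assms(2) by (intro keys_wgen) (auto intro: finite_subset)
  then show "keys ` wgen d ` E = E" by (auto simp: image_image)
  show "wgen d ` E \<subseteq> monomials n" using k assms(1) by (auto simp: monomials_def)
qed

text \<open>Let \<open>P\<close> be the annihilator of \<open>f\<close> modulo the ideal, and
  \<open>m\<close> a monomial of \<open>f\<close> outside the ideal. The variables whose exponent in
  \<open>m\<close> is below \<open>d\<close> form a cover \<open>T\<close>; take a minimal cover
  \<open>C\<close> inside it. The irreducible ideal \<open>Q\<close> of \<open>C\<close> contains
  the ideal but not \<open>m\<close>, so \<open>primary_cancel\<close> puts \<open>P\<close> inside
  the prime of \<open>C\<close>, and minimality of \<open>C\<close> gives equality.\<close>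

lemma weighted_ass_prime:
  fixes P :: "'k::field mpoly set"
  assumes E: "\<And>e. e \<in> E \<Longrightarrow> e \<subseteq> {..<n}" and d: "\<And>i. i < n \<Longrightarrow> 0 < d i"
    and P: "P \<in> ass_primes n (mspan (upclosure n (wgen d ` E)))"
  shows "\<exists>C. min_cover n E C \<and> P = mspan (hits n C)"
proof -
  define A where "A = upclosure n (wgen d ` E)"
  have W: "keys ` wgen d ` E = E" "wgen d ` E \<subseteq> monomials n"
    using weighted_gens[of E n d] E d by auto
  have finE: "finite e" if "e \<in> E" for e using E[OF that] by (rule finite_subset) simp
  obtain f where f: "f \<in> polyring n" "P = {g \<in> polyring n. g * f \<in> mspan A}"
    using P by (auto simp: ass_primes_def A_def)
  have prime: "is_prime_ideal n P" and IP: "mspan A \<subseteq> P"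
    using ass_primesD[OF P] by (auto simp: is_ideal_mspan upset_upclosure A_def)
  have "f \<notin> mspan A"
    using prime f by (auto simp: is_prime_ideal_def polyring_def)
  then obtain m where m: "m \<in> keys f" "m \<notin> A" by (auto simp: mspan_def)
  then have mn: "m \<in> monomials n" using f by (auto simp: polyring_eq_mspan mspan_def)
  define T where "T = {i. i < n \<and> lookup m i < d i}"
  have "cover n E T"
    unfolding cover_def
  proof (intro conjI ballI notI)
    fix e assume e: "e \<in> E" "e \<inter> T = {}"
    then have "mdvd (wgen d e) m"
      using finE[OF e(1)] E[OF e(1)] by (auto simp: mdvd_def lookup_wgen T_def)
    then show False using m mn e by (auto simp: A_def upclosure_def)
  qed (auto simp: T_def)
  then obtain C where C: "C \<subseteq> T" "min_cover n E C" using ex_min_cover[OF \<open>cover n E T\<close>] by blast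
  then have cC: "cover n E C" "C \<subseteq> {..<n}" by (auto simp: min_cover_def cover_def)
  define Q where "Q = {m \<in> monomials n. \<exists>i\<in>C. d i \<le> lookup m i}"
  have "A \<subseteq> Q"
  proof
    fix u assume u: "u \<in> A"
    then obtain e where e: "e \<in> E" "mdvd (wgen d e) u" by (auto simp: A_def upclosure_def)
    then obtain i where i: "i \<in> e" "i \<in> C" using cC by (auto simp: cover_def)
    have "lookup (wgen d e) i \<le> lookup u i" using e by (simp add: mdvd_def)
    then show "u \<in> Q" using u i finE[OF e(1)] by (auto simp: Q_def lookup_wgen A_def upclosure_def)
  qed
  have upQ: "upset n Q"
    by (auto simp: upset_def Q_def monomials_add lookup_add intro: trans_le_add2)
  have "P \<subseteq> mspan (hits n C)"
  proof
    fix g assume g: "g \<in> P"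
    show "g \<in> mspan (hits n C)"
    proof (rule ccontr)
      assume nh: "g \<notin> mspan (hits n C)"
      have gf: "g \<in> polyring n" "g * f \<in> mspan Q"
        using g f \<open>A \<subseteq> Q\<close> by (auto simp: mspan_def)
      have "f \<in> mspan Q"
      proof (rule primary_cancel[OF upQ _ gf(1) nh f(1) gf(2)])
        fix u m assume "keys u \<inter> C = {}" "m \<in> monomials n" "u + m \<in> Q"
        moreover from this have "lookup u i = 0" if "i \<in> C" for i
          using that by (metis disjoint_iff in_keys_iff)
        ultimately show "m \<in> Q" by (auto simp: Q_def lookup_add)
      qed
      then have "m \<in> Q" using m by (auto simp: mspan_def)
      then show False using C by (auto simp: Q_def T_def)
    qed
  qed
  then have "vars_in n P \<subseteq> C"
    using vars_in_hits[OF cC(2), where 'k='k] by (auto simp: vars_in_def)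
  moreover have "cover n E (vars_in n P)"
    using cover_vars_in[OF W(2) prime] IP by (simp add: W(1) A_def)
  ultimately have "vars_in n P = C" using C by (auto simp: min_cover_def)
  then have "mspan (hits n C) \<subseteq> P"
    using hits_vars_in_subset[of n P] prime by (auto simp: is_prime_ideal_def)
  then show ?thesis using C \<open>P \<subseteq> mspan (hits n C)\<close> by blast
qed

lemma weighted_no_embedded_prime:
  assumes E: "\<And>e. e \<in> E \<Longrightarrow> e \<subseteq> {..<n}" and d: "\<And>i. i < n \<Longrightarrow> 0 < d i"
  shows "\<not> has_embedded_prime n (mspan (upclosure n (wgen d ` E)) :: 'k::field mpoly set)"
proof
  assume "has_embedded_prime n (mspan (upclosure n (wgen d ` E)) :: 'k mpoly set)"
  then obtain P Q :: "'k mpoly set" where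
    PQ: "P \<in> ass_primes n (mspan (upclosure n (wgen d ` E)))"
        "Q \<in> ass_primes n (mspan (upclosure n (wgen d ` E)))" "Q \<subset> P"
    by (auto simp: has_embedded_prime_def)
  have "\<exists>C. min_cover n E C \<and> R = mspan (hits n C)"
    if "R \<in> ass_primes n (mspan (upclosure n (wgen d ` E)))" for R :: "'k mpoly set"
    using E d that by (rule weighted_ass_prime)
  with PQ obtain C D where CD: "min_cover n E C" "P = mspan (hits n C)" "min_cover n E D" "Q = mspan (hits n D)" by meson
  then have "C \<subseteq> {..<n}" "D \<subseteq> {..<n}" by (auto simp: min_cover_def cover_def)
  then have "D \<subseteq> C" using PQ(3) CD prime_hits_subset_iff[of D n C, where 'k='k] by blast
  then have "D = C" using CD by (auto simp: min_cover_def)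
  then show False using PQ(3) CD by simp
qed

section \<open>Symbolic powers\<close>

lemma ideal_pow_subset_sym_pow:
  fixes I :: "'k::field mpoly set"
  assumes "is_ideal n (ideal_pow n I s)"
  shows "ideal_pow n I s \<subseteq> sym_pow n I s"
proof
  fix f assume f: "f \<in> ideal_pow n I s"
  then have "f \<in> polyring n" using assms by (auto simp: is_ideal_def)
  moreover have "\<exists>g\<in>polyring n - P. g * f \<in> ideal_pow n I s" if "P \<in> min_primes n I" for P
    using f that by (intro bexI[of _ 1]) (auto simp: min_primes_def is_prime_ideal_def polyring_def)
  ultimately show "f \<in> sym_pow n I s" by (simp add: sym_pow_def)
qed

text \<open>Integer division is superadditive. The case \<open>k = 1\<close> serves for generators
  meeting a cover, \<open>k = 2\<close> for counting both ends of each edge.\<close>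

lemma sum_div_sum_list_ge:
  fixes d :: "nat \<Rightarrow> nat"
  assumes "\<And>g. g \<in> set gs \<Longrightarrow> k \<le> (\<Sum>i\<in>C. lookup g i div d i)"
  shows "k * length gs \<le> (\<Sum>i\<in>C. lookup (sum_list gs) i div d i)"
  using assms
proof (induction gs)
  case (Cons g gs)
  have "k * length (g # gs) \<le> (\<Sum>i\<in>C. lookup g i div d i) + (\<Sum>i\<in>C. lookup (sum_list gs) i div d i)"
    using Cons by (simp add: add_mono)
  also have "\<dots> \<le> (\<Sum>i\<in>C. lookup (sum_list (g # gs)) i div d i)"
    unfolding sum.distrib[symmetric]
  proof (intro sum_mono)
    fix i
    show "lookup g i div d i + lookup (sum_list gs) i div d i \<le> lookup (sum_list (g # gs)) i div d i"
      using div_add1_eq[of "lookup g i" "lookup (sum_list gs) i" "d i"] by (simp add: lookup_add)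
  qed
  finally show ?case .
qed simp

lemma lookup_sum_list_wgen:
  assumes "\<And>e. e \<in> set es \<Longrightarrow> finite e"
  shows "lookup (sum_list (map (wgen d) es)) i = d i * length (filter (\<lambda>e. i \<in> e) es)"
  using assms by (induction es) (auto simp: lookup_add lookup_wgen)

text \<open>Localising at a minimal cover bounds the capacities \<open>lookup m i div d i\<close>
  from below on that cover. The matching theorem then gives \<open>s\<close> edges within these
  capacities, whose weighted product divides \<open>m\<close>.\<close>

lemma weighted_bipartite_sym_pow_eq:
  assumes E: "\<And>e. e \<in> E \<Longrightarrow> \<exists>a b. e = {a, b} \<and> a < n \<and> b < n \<and> a \<in> L \<and> b \<notin> L"
    and d: "\<And>i. i < n \<Longrightarrow> 0 < d i"
  shows "sym_pow n (mspan (upclosure n (wgen d ` E)) :: 'k::field mpoly set) s =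
    ideal_pow n (mspan (upclosure n (wgen d ` E))) s"
proof
  have En: "e \<subseteq> {..<n}" if "e \<in> E" for e using E[OF that] by auto
  have W: "keys ` wgen d ` E = E" "wgen d ` E \<subseteq> monomials n"
    using weighted_gens[of E n d] En d by auto
  have finE: "finite e" if "e \<in> E" for e using En[OF that] by (rule finite_subset) simp
  note pow = ideal_pow_mspan[OF W(2), of s, where 'k='k]
  show "ideal_pow n (mspan (upclosure n (wgen d ` E)) :: 'k mpoly set) s \<subseteq> sym_pow n (mspan (upclosure n (wgen d ` E))) s"
    by (intro ideal_pow_subset_sym_pow) (simp add: pow is_ideal_mspan upset_upclosure)
  show "sym_pow n (mspan (upclosure n (wgen d ` E)) :: 'k mpoly set) s \<subseteq> ideal_pow n (mspan (upclosure n (wgen d ` E))) s"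
    unfolding pow
  proof
    fix f :: "'k mpoly" assume f: "f \<in> sym_pow n (mspan (upclosure n (wgen d ` E))) s"
    then have fn: "f \<in> polyring n" by (simp add: sym_pow_def)
    show "f \<in> mspan (upclosure n {sum_list gs |gs. length gs = s \<and> set gs \<subseteq> wgen d ` E})"
      unfolding mspan_def
    proof (intro CollectI subsetI)
      fix m assume m: "m \<in> keys f"
      then have mn: "m \<in> monomials n" using fn by (auto simp: polyring_eq_mspan mspan_def)
      have min: "s \<le> (\<Sum>i\<in>C. lookup m i div d i)" if C: "min_cover n E C" for C
      proof -
        \<comment> \<open>\<open>B\<close> contains all monomials of the ordinary power and is
          insensitive to factors free of \<open>C\<close>, so \<open>primary_cancel\<close> removes
          the multiplier \<open>g\<close> from \<open>g * f\<close>.\<close>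
        define B where "B = {m \<in> monomials n. s \<le> (\<Sum>i\<in>C. lookup m i div d i)}"
        have "mspan (hits n C) \<in> min_primes n (mspan (upclosure n (wgen d ` E)) :: 'k mpoly set)"
          unfolding min_primes_eq[OF W(2)] W(1) using C by blast
        then obtain g where g: "g \<in> polyring n" "g \<notin> mspan (hits n C)"
          "g * f \<in> mspan (upclosure n {sum_list gs |gs. length gs = s \<and> set gs \<subseteq> wgen d ` E})"
          using f unfolding sym_pow_def pow by blast
        have "upclosure n {sum_list gs |gs. length gs = s \<and> set gs \<subseteq> wgen d ` E} \<subseteq> B"
        proof
          fix u assume "u \<in> upclosure n {sum_list gs |gs. length gs = s \<and> set gs \<subseteq> wgen d ` E}"
          then obtain gs where gs: "u \<in> monomials n" "length gs = s" "set gs \<subseteq> wgen d ` E" "mdvd (sum_list gs) u"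
            by (auto simp: upclosure_def)
          have "1 \<le> (\<Sum>i\<in>C. lookup g i div d i)" if g: "g \<in> set gs" for g
          proof -
            obtain e where e: "e \<in> E" "g = wgen d e" using gs g by blast
            then have "e \<inter> C \<noteq> {}" using C by (simp add: min_cover_def cover_def)
            then obtain i where i: "i \<in> e" "i \<in> C" by blast
            have "finite C" using C by (auto simp: min_cover_def cover_def intro: finite_subset)
            have "1 = lookup g i div d i"
              using i e finE[OF e(1)] d[of i] En[OF e(1)] by (auto simp: lookup_wgen)
            also have "\<dots> \<le> (\<Sum>i\<in>C. lookup g i div d i)"
              using i \<open>finite C\<close> by (intro member_le_sum) auto
            finally show ?thesis .
          qed
          then have "1 * length gs \<le> (\<Sum>i\<in>C. lookup (sum_list gs) i div d i)"
            by (rule sum_div_sum_list_ge)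
          also have "\<dots> \<le> (\<Sum>i\<in>C. lookup u i div d i)"
            using gs by (intro sum_mono div_le_mono) (simp add: mdvd_def)
          finally show "u \<in> B" using gs by (simp add: B_def)
        qed
        then have gf: "g * f \<in> mspan B" using g by (auto simp: mspan_def)
        have upB: "upset n B"
          unfolding upset_def
        proof (intro conjI ballI)
          fix m u assume mu: "m \<in> B" "u \<in> monomials n"
          have "(\<Sum>i\<in>C. lookup m i div d i) \<le> (\<Sum>i\<in>C. lookup (u + m) i div d i)"
            by (intro sum_mono div_le_mono) (simp add: lookup_add)
          then show "u + m \<in> B" using mu by (auto simp: B_def monomials_add)
        qed (auto simp: B_def)
        have "f \<in> mspan B"
        proof (rule primary_cancel[OF upB _ g(1,2) fn gf])
          fix u m assume um: "keys u \<inter> C = {}" "m \<in> monomials n" "u + m \<in> B"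
          have "lookup u i = 0" if "i \<in> C" for i
            using um that by (metis disjoint_iff in_keys_iff)
          then have "(\<Sum>i\<in>C. lookup (u + m) i div d i) = (\<Sum>i\<in>C. lookup m i div d i)"
            by (intro sum.cong) (auto simp: lookup_add)
          then show "m \<in> B" using um by (simp add: B_def)
        qed
        then show ?thesis using m by (auto simp: mspan_def B_def)
      qed
      have cov: "s \<le> (\<Sum>i\<in>C. lookup m i div d i)" if "C \<subseteq> {..<n}" "\<forall>e\<in>E. e \<inter> C \<noteq> {}" for C
      proof -
        obtain D where D: "D \<subseteq> C" "min_cover n E D"
          using ex_min_cover[of n E C] \<open>C \<subseteq> {..<n}\<close> \<open>\<forall>e\<in>E. e \<inter> C \<noteq> {}\<close> by (auto simp: cover_def)
        have "(\<Sum>i\<in>D. lookup m i div d i) \<le> (\<Sum>i\<in>C. lookup m i div d i)"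
          using D that by (intro sum_mono2) (auto intro: finite_subset)
        then show ?thesis using min[OF D(2)] by simp
      qed
      have "\<exists>es. length es = s \<and> set es \<subseteq> E \<and> (\<forall>v. length (filter (\<lambda>e. v \<in> e) es) \<le> lookup m v div d v)"
        using E cov by (intro bipartite_capacitated_matching[where V = "{..<n}" and L = L]) auto
      then obtain es where es: "length es = s" "set es \<subseteq> E"
        "\<And>v. length (filter (\<lambda>e. v \<in> e) es) \<le> lookup m v div d v" by blast
      have "lookup (sum_list (map (wgen d) es)) i \<le> lookup m i" for i
      proof -
        have "lookup (sum_list (map (wgen d) es)) i = d i * length (filter (\<lambda>e. i \<in> e) es)"
          using es finE by (intro lookup_sum_list_wgen) auto
        also have "\<dots> \<le> d i * (lookup m i div d i)" using es by simp
        also have "\<dots> \<le> lookup m i" by simp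
        finally show ?thesis .
      qed
      then have "mdvd (sum_list (map (wgen d) es)) m" by (simp add: mdvd_def)
      moreover have "sum_list (map (wgen d) es) \<in> {sum_list gs |gs. length gs = s \<and> set gs \<subseteq> wgen d ` E}"
        using es by (intro CollectI exI[of _ "map (wgen d) es"]) auto
      ultimately show "m \<in> upclosure n {sum_list gs |gs. length gs = s \<and> set gs \<subseteq> wgen d ` E}"
        using mn by (intro upclosureI)
    qed
  qed
qed

text \<open>The witness is the product of all \<open>x\<^sub>i\<close> raised to \<open>d i\<close>.\<close>
lemma weighted_sym_pow_neq:
  assumes E: "\<And>e. e \<in> E \<Longrightarrow> e \<subseteq> {..<n} \<and> card e = 2" and d: "\<And>i. i < n \<Longrightarrow> 0 < d i"
    and cov: "\<And>C. cover n E C \<Longrightarrow> s \<le> card C" and s: "n < 2 * s"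
  shows "sym_pow n (mspan (upclosure n (wgen d ` E)) :: 'k::field mpoly set) s \<noteq>
    ideal_pow n (mspan (upclosure n (wgen d ` E))) s"
proof -
  have En: "e \<subseteq> {..<n}" if "e \<in> E" for e using E[OF that] by auto
  have W: "keys ` wgen d ` E = E" "wgen d ` E \<subseteq> monomials n"
    using weighted_gens[of E n d] En d by auto
  have finE: "finite e" if "e \<in> E" for e using En[OF that] by (rule finite_subset) simp
  note pow = ideal_pow_mspan[OF W(2), of s, where 'k='k]
  let ?S = "{sum_list gs |gs. length gs = s \<and> set gs \<subseteq> wgen d ` E}"
  let ?f = "wgen d {..<n}"
  have fn: "?f \<in> monomials n" using keys_wgen_subset[of "{..<n}" d] by (simp add: monomials_def)
  have "?f \<notin> upclosure n ?S"
  proof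
    assume "?f \<in> upclosure n ?S"
    then obtain gs where gs: "length gs = s" "set gs \<subseteq> wgen d ` E" "mdvd (sum_list gs) ?f"
      by (auto simp: upclosure_def)
    \<comment> \<open>Each generator consumes two of the \<open>n\<close> units of capacity in
      \<open>?f\<close>, whereas \<open>s\<close> generators would need
      \<open>2 * s > n\<close>.\<close>
    have "2 \<le> (\<Sum>i<n. lookup g i div d i)" if g: "g \<in> set gs" for g
    proof -
      obtain e where e: "e \<in> E" "g = wgen d e" using gs g by blast
      have "2 = (\<Sum>i\<in>e. 1::nat)" using E[OF e(1)] by simp
      also have "\<dots> = (\<Sum>i\<in>e. lookup g i div d i)"
        using e finE[OF e(1)] E[OF e(1)] d by (intro sum.cong) (auto simp: lookup_wgen subset_iff)
      also have "\<dots> \<le> (\<Sum>i<n. lookup g i div d i)"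
        using E[OF e(1)] by (intro sum_mono2) auto
      finally show ?thesis .
    qed
    then have "2 * length gs \<le> (\<Sum>i<n. lookup (sum_list gs) i div d i)"
      by (rule sum_div_sum_list_ge)
    also have "\<dots> \<le> (\<Sum>i<n. lookup ?f i div d i)"
      using gs by (intro sum_mono div_le_mono) (simp add: mdvd_def)
    also have "\<dots> = n" using d by (simp add: lookup_wgen)
    finally show False using s gs by simp
  qed
  then have "(monom ?f :: 'k mpoly) \<notin> ideal_pow n (mspan (upclosure n (wgen d ` E))) s"
    by (simp add: pow monom_in_mspan)
  moreover have "(monom ?f :: 'k mpoly) \<in> sym_pow n (mspan (upclosure n (wgen d ` E))) s"
    unfolding sym_pow_def pow min_primes_eq[OF W(2)] W(1)
  proof (intro CollectI conjI ballI)
    show "(monom ?f :: 'k mpoly) \<in> polyring n" using fn by (simp add: polyring_eq_mspan monom_in_mspan)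
    fix P :: "'k mpoly set" assume "P \<in> (\<lambda>C. mspan (hits n C)) ` {C. min_cover n E C}"
    then obtain C where C: "min_cover n E C" "P = mspan (hits n C)" by blast
    then have cC: "cover n E C" "C \<subseteq> {..<n}" by (auto simp: min_cover_def cover_def)
    then have finC: "finite C" by (auto intro: finite_subset)
    \<comment> \<open>Minimality of the cover gives each of its vertices a private edge.\<close>
    have "\<exists>e\<in>E. e \<inter> C = {i}" if "i \<in> C" for i
    proof -
      have "\<not> cover n E (C - {i})" using C that by (auto simp: min_cover_def)
      then obtain e where "e \<in> E" "e \<inter> (C - {i}) = {}" using cC by (auto simp: cover_def)
      moreover have "e \<inter> C \<noteq> {}" using \<open>e \<in> E\<close> cC by (auto simp: cover_def)
      ultimately show ?thesis by (intro bexI[of _ e]) auto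
    qed
    then obtain ed where ed: "\<And>i. i \<in> C \<Longrightarrow> ed i \<in> E \<and> ed i \<inter> C = {i}" by metis
    \<comment> \<open>There are at least \<open>s\<close> vertices in \<open>C\<close>; the private
      edges of \<open>s\<close> distinct ones use each vertex of \<open>C\<close> at most once, as
      the exponents of \<open>?f\<close> allow.\<close>
    define xs where "xs = take s (sorted_list_of_set C)"
    have xs: "length xs = s" "set xs \<subseteq> C" "distinct xs"
      using cov[OF cC(1)] finC set_take_subset[of s "sorted_list_of_set C"] by (auto simp: xs_def)
    define es where "es = map ed xs"
    have es: "length es = s" "set es \<subseteq> E" using xs ed by (auto simp: es_def)
    \<comment> \<open>Supplies the other ends of the chosen edges, at most \<open>s\<close> times
      each, while staying outside the prime of \<open>C\<close>.\<close>
    define g where "g = wgen (\<lambda>j. s * d j) ({..<n} - C)"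
    have kg: "keys g \<subseteq> {..<n} - C" unfolding g_def by (rule keys_wgen_subset) simp
    then have gn: "g \<in> monomials n" by (auto simp: monomials_def)
    have "lookup (sum_list (map (wgen d) es)) i \<le> lookup (g + ?f) i" for i
    proof -
      have l: "lookup (sum_list (map (wgen d) es)) i = d i * length (filter (\<lambda>e. i \<in> e) es)"
        using es finE by (intro lookup_sum_list_wgen) auto
      consider "i \<in> C" | "i \<notin> C" "i < n" | "\<not> i < n" by blast
      then show ?thesis
      proof cases
        case 1
        have "length (filter (\<lambda>e. i \<in> e) es) = card ({x. i \<in> ed x} \<inter> set xs)"
          using xs by (simp add: es_def filter_map o_def distinct_length_filter)
        also have "\<dots> \<le> card {i}"
        proof (intro card_mono subsetI)
          fix x assume "x \<in> {x. i \<in> ed x} \<inter> set xs"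
          then have "i \<in> ed x \<inter> C" "ed x \<inter> C = {x}" using ed[of x] xs 1 by auto
          then show "x \<in> {i}" by simp
        qed simp
        finally have "d i * length (filter (\<lambda>e. i \<in> e) es) \<le> d i" by simp
        moreover have "lookup ?f i = d i" using 1 cC by (auto simp: lookup_wgen)
        ultimately show ?thesis unfolding l lookup_add by (metis trans_le_add2)
      next
        case 2
        have "length (filter (\<lambda>e. i \<in> e) es) \<le> s" using es length_filter_le by metis
        then have "d i * length (filter (\<lambda>e. i \<in> e) es) \<le> s * d i" by simp
        moreover have "lookup g i = s * d i" using 2 by (simp add: g_def lookup_wgen)
        ultimately show ?thesis unfolding l lookup_add by (metis trans_le_add1)
      next
        case 3
        then have "filter (\<lambda>e. i \<in> e) es = []" using es En by (auto simp: filter_empty_conv)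
        then show ?thesis by (simp add: l)
      qed
    qed
    then have "mdvd (sum_list (map (wgen d) es)) (g + ?f)" by (simp add: mdvd_def)
    moreover have "sum_list (map (wgen d) es) \<in> ?S"
      using es by (intro CollectI exI[of _ "map (wgen d) es"]) auto
    ultimately have "g + ?f \<in> upclosure n ?S"
      using gn fn by (intro upclosureI) (auto simp: monomials_add)
    then have "(monom g * monom ?f :: 'k mpoly) \<in> mspan (upclosure n ?S)"
      by (simp add: monom_mult monom_in_mspan)
    moreover have "(monom g :: 'k mpoly) \<in> polyring n - P"
      using kg gn C by (auto simp: polyring_eq_mspan monom_in_mspan hits_def)
    ultimately show "\<exists>g\<in>polyring n - P. g * monom ?f \<in> mspan (upclosure n ?S)" by blast
  qed
  ultimately show ?thesis by blast
qed

text \<open>If \<open>P\<close>, the annihilator of \<open>f\<close> modulo \<open>I\<close>, is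
  embedded, it lies in no minimal prime. Hence \<open>f\<close> is in the first symbolic power,
  which equals \<open>I\<close>, and \<open>P\<close> would contain 1.\<close>

lemma sym_pow_one_no_embedded_prime:
  fixes I :: "'k::field mpoly set"
  assumes I: "is_ideal n I" and eq: "sym_pow n I 1 = ideal_pow n I 1"
  shows "\<not> has_embedded_prime n I"
proof
  assume "has_embedded_prime n I"
  then obtain P Q where PQ: "P \<in> ass_primes n I" "Q \<in> ass_primes n I" "Q \<subset> P"
    by (auto simp: has_embedded_prime_def)
  obtain f where f: "f \<in> polyring n" "P = {g \<in> polyring n. g * f \<in> I}"
    using PQ by (auto simp: ass_primes_def)
  have one: "ideal_pow n I 1 = I"
    unfolding ideal_pow_def
  proof (rule gen_ideal_eqI[OF I])
    have "{prod_list fs |fs. length fs = 1 \<and> set fs \<subseteq> I} = I"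
      by (auto simp: length_Suc_conv) (metis list.set(1,2) empty_subsetI insert_subset list.size(3) mult.right_neutral prod_list.Cons prod_list.Nil)
    then show "{prod_list fs |fs. length fs = 1 \<and> set fs \<subseteq> I} \<subseteq> I"
      "\<And>K. {prod_list fs |fs. length fs = 1 \<and> set fs \<subseteq> I} \<subseteq> K \<Longrightarrow> I \<subseteq> K" by auto
  qed
  have "f \<in> sym_pow n I 1"
    unfolding sym_pow_def one
  proof (intro CollectI conjI ballI)
    fix R assume R: "R \<in> min_primes n I"
    have "\<not> P \<subseteq> R"
    proof
      assume "P \<subseteq> R"
      then have "Q = R" using R PQ ass_primesD[OF PQ(2) I] unfolding min_primes_def by blast
      then show False using PQ \<open>P \<subseteq> R\<close> by blast
    qed
    then show "\<exists>g\<in>polyring n - R. g * f \<in> I" using f by blast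
  qed (rule f(1))
  then have "f \<in> I" using eq one by simp
  then have "1 \<in> P" using f by (auto simp: polyring_def)
  then show False using ass_primesD(1)[OF PQ(1) I] by (simp add: is_prime_ideal_def)
qed

section \<open>Cycles\<close>

text \<open>Fix one member \<open>g0\<close>: every other has a smaller exponent than
  \<open>g0\<close> in one of the two variables. Either exponent determines a member of the
  antichain, so only finitely many remain.\<close>

lemma finite_antichain_two_variables:
  assumes anti: "\<And>g h. g \<in> G \<Longrightarrow> h \<in> G \<Longrightarrow> mdvd g h \<Longrightarrow> g = h"
  shows "finite {g \<in> G. keys g = {i, j}}"
proof -
  define H where "H = {g \<in> G. keys g = {i, j}}"
  have outside: "lookup g k = 0" if "g \<in> H" "k \<noteq> i" "k \<noteq> j" for g k
    using that unfolding H_def by (metis (mono_tags, lifting) mem_Collect_eq in_keys_iff insertE singletonD)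
  have dvdI: "mdvd g h" if "g \<in> H" "h \<in> H" "lookup g i \<le> lookup h i" "lookup g j \<le> lookup h j" for g h
    unfolding mdvd_def using that outside by (metis le0)
  have anti': "g = h" if "g \<in> H" "h \<in> H" "lookup g i \<le> lookup h i" "lookup g j \<le> lookup h j" for g h
    using dvdI[OF that] anti that by (auto simp: H_def)
  show ?thesis
  proof (cases "H = {}")
    case False
    then obtain g0 where g0: "g0 \<in> H" by blast
    have "inj_on (\<lambda>g. lookup g i) {g \<in> H. lookup g i < lookup g0 i}"
      by (rule inj_onI) (metis (mono_tags, lifting) anti' mem_Collect_eq nle_le order_refl)
    then have "finite {g \<in> H. lookup g i < lookup g0 i}"
      by (rule inj_on_finite[where B = "{..<lookup g0 i}"]) auto
    moreover have "inj_on (\<lambda>g. lookup g j) {g \<in> H. lookup g j < lookup g0 j}"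
      by (rule inj_onI) (metis (mono_tags, lifting) anti' mem_Collect_eq nle_le order_refl)
    then have "finite {g \<in> H. lookup g j < lookup g0 j}"
      by (rule inj_on_finite[where B = "{..<lookup g0 j}"]) auto
    moreover have "H \<subseteq> {g0} \<union> {g \<in> H. lookup g i < lookup g0 i} \<union> {g \<in> H. lookup g j < lookup g0 j}"
    proof
      fix g assume "g \<in> H"
      then show "g \<in> {g0} \<union> {g \<in> H. lookup g i < lookup g0 i} \<union> {g \<in> H. lookup g j < lookup g0 j}"
        using anti'[OF g0, of g] by (cases "lookup g i < lookup g0 i"; cases "lookup g j < lookup g0 j") auto
    qed
    ultimately have "finite H" by (meson finite.simps finite_UnI finite_subset)
    then show ?thesis by (simp add: H_def)
  next
    case True
    then show ?thesis unfolding H_def by (metis finite.emptyI)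
  qed
qed

section \<open>Adjacency in the cycle\<close>

lemma Suc_mod_eq: "i < n \<Longrightarrow> Suc i mod n = (if Suc i = n then 0 else Suc i)"
  by (simp add: mod_Suc)

lemma cycle_edge_iff:
  "{i, j} \<in> cycle_edges n \<longleftrightarrow>
    i < n \<and> j < n \<and> (Suc i = j \<or> Suc j = i \<or> (Suc i = n \<and> j = 0) \<or> (Suc j = n \<and> i = 0))"
proof -
  have "{i, j} \<in> cycle_edges n \<longleftrightarrow> i < n \<and> j = Suc i mod n \<or> j < n \<and> i = Suc j mod n"
    by (auto simp: cycle_edges_def doubleton_eq_iff)
  then show ?thesis by (auto simp: Suc_mod_eq split: if_splits)
qed

lemma cycle_edgesE:
  assumes "e \<in> cycle_edges n" "n \<ge> 2"
  obtains i j where "e = {i, j}" "i < n" "j < n" "i \<noteq> j"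
proof -
  obtain i where i: "e = {i, Suc i mod n}" "i < n" using assms by (auto simp: cycle_edges_def)
  then have "Suc i mod n \<noteq> i" "Suc i mod n < n" using assms by (auto simp: Suc_mod_eq)
  then show ?thesis using that i by metis
qed

lemma cycle_edge_at:
  assumes "e \<in> cycle_edges n" "n \<ge> 2" "v \<in> e"
  obtains u where "e = {u, v}" "u \<noteq> v" "{u, v} \<in> cycle_edges n"
  using cycle_edgesE[OF assms(1,2)] assms(1,3) by (metis doubleton_eq_iff insertE singletonD)

lemma cycle_other_edge:
  assumes "n \<ge> 3" "{u, v} \<in> cycle_edges n"
  obtains w where "w \<noteq> u" "{v, w} \<in> cycle_edges n"
proof -
  have v: "v < n" using assms by (simp add: cycle_edge_iff)
  define a where "a = (if Suc v = n then 0 else Suc v)"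
  define b where "b = (if v = 0 then n - 1 else v - 1)"
  have "{v, a} \<in> cycle_edges n" "{v, b} \<in> cycle_edges n" "a \<noteq> b"
    using assms(1) v by (auto simp: a_def b_def cycle_edge_iff)
  then show ?thesis using that by metis
qed

text \<open>The path \<open>s, t, u, v, w\<close>; for \<open>n \<ge> 6\<close> its ends are not adjacent.\<close>
lemma cycle_path:
  assumes n: "n \<ge> 6" and uv: "{u, v} \<in> cycle_edges n" and vw: "{v, w} \<in> cycle_edges n" and "u \<noteq> w"
  obtains s t where "{s, t} \<in> cycle_edges n" "s \<noteq> v" "s \<noteq> w" "{s, v} \<notin> cycle_edges n" "{s, w} \<notin> cycle_edges n"
    "\<And>j. {u, j} \<in> cycle_edges n \<Longrightarrow> j = t \<or> j = v"
proof -
  \<comment> \<open>The path from \<open>u\<close> through \<open>v\<close> to \<open>w\<close>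
    follows either successors or predecessors; \<open>t\<close> and \<open>s\<close> are reached by
    continuing from \<open>u\<close> in the opposite direction.\<close>
  define sc where "sc i = (if Suc i = n then 0 else Suc i)" for i
  define pr where "pr i = (if i = 0 then n - 1 else i - 1)" for i
  have "v = sc u \<and> w = sc v \<or> v = pr u \<and> w = pr v"
    using assms by (auto simp: cycle_edge_iff sc_def pr_def)
  then show ?thesis
  proof
    assume *: "v = sc u \<and> w = sc v"
    show ?thesis
      by (rule that[of "pr (pr u)" "pr u"])
        (use * n uv in \<open>auto simp: cycle_edge_iff sc_def pr_def split: if_splits\<close>)
  next
    assume *: "v = pr u \<and> w = pr v"
    show ?thesis
      by (rule that[of "sc (sc u)" "sc u"])
        (use * n uv in \<open>auto simp: cycle_edge_iff sc_def pr_def split: if_splits\<close>)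
  qed
qed

text \<open>If the exponents of \<open>x\<^sub>v\<close> in the generators \<open>g\<close> on \<open>uv\<close> and \<open>h\<close> on \<open>vw\<close> satisfy
  \<open>g\<^sub>v < h\<^sub>v\<close>, then \<open>h / x\<^sub>v\<close> times a power of \<open>x\<^sub>s\<close> lies outside the ideal but is multiplied into it
  by powers of \<open>x\<^sub>t\<close>, \<open>x\<^sub>u\<close> and \<open>x\<^sub>v\<close>.\<close>
lemma cycle_exponent_le:
  assumes n: "n \<ge> 6" and G: "G \<subseteq> monomials n" "finite G"
    and anti: "\<And>g h. g \<in> G \<Longrightarrow> h \<in> G \<Longrightarrow> mdvd g h \<Longrightarrow> g = h"
    and E: "keys ` G = cycle_edges n"
    and no: "\<not> has_embedded_prime n (mspan (upclosure n G) :: 'k::field mpoly set)"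
    and g: "g \<in> G" "keys g = {u, v}" and h: "h \<in> G" "keys h = {v, w}" and "u \<noteq> w"
  shows "lookup h v \<le> lookup g v"
proof (rule ccontr)
  assume less: "\<not> lookup h v \<le> lookup g v"
  have n2: "n \<ge> 2" using n by simp
  have uv: "{u, v} \<in> cycle_edges n" and vw: "{v, w} \<in> cycle_edges n" 
    using imageI[OF g(1), of keys] imageI[OF h(1), of keys] g(2) h(2) E by simp_all
  obtain s t where st: "{s, t} \<in> cycle_edges n" "s \<noteq> v" "s \<noteq> w" "{s, v} \<notin> cycle_edges n" "{s, w} \<notin> cycle_edges n"
    "\<And>j. {u, j} \<in> cycle_edges n \<Longrightarrow> j = t \<or> j = v"
    using cycle_path[OF n uv vw \<open>u \<noteq> w\<close>] by blast
  obtain k where k: "k \<in> G" "keys k = {s, t}" using st(1) E by (metis imageE)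
  have bounds: "s < n" "t < n" "u < n" "v < n" "u \<noteq> v" "s \<noteq> t"
    using st(1) uv n by (auto simp: cycle_edge_iff)
  define f where "f = (h - single v 1) + single s (lookup k s)"
  have lf: "lookup f i = lookup h i - (if i = v then 1 else 0) + (if i = s then lookup k s else 0)" for i
    by (simp add: f_def lookup_add lookup_minus lookup_single when_def)
  have hs: "lookup h i = 0" if "i \<noteq> v" "i \<noteq> w" for i using that h by (metis in_keys_iff insertE singletonD)
  have gs: "lookup g i = 0" if "i \<noteq> u" "i \<noteq> v" for i using that g by (metis in_keys_iff insertE singletonD)
  have ks: "lookup k i = 0" if "i \<noteq> s" "i \<noteq> t" for i using that k by (metis in_keys_iff insertE singletonD)
  have hv: "lookup h v > 0" using less by simp
  have kf: "keys f \<subseteq> {v, w, s}"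
    using hs by (auto simp: in_keys_iff lf split: if_splits)
  have fn: "f \<in> monomials n"
    using kf bounds vw by (auto simp: monomials_def cycle_edge_iff)
  have "f \<notin> upclosure n G"
  proof
    assume "f \<in> upclosure n G"
    then obtain q where q: "q \<in> G" "mdvd q f" by (auto simp: upclosure_def)
    then have kq: "keys q \<subseteq> {v, w, s}" using kf keys_mono by blast
    have "keys q \<in> cycle_edges n" using q E by blast
    then obtain a b where ab: "keys q = {a, b}" "a \<noteq> b" "{a, b} \<in> cycle_edges n"
      using cycle_edgesE[OF _ n2, of "keys q"] by metis
    \<comment> \<open>The support of \<open>q\<close> is an edge within \<open>{v, w, s}\<close>,
      and \<open>s\<close> is adjacent to neither \<open>v\<close> nor \<open>w\<close>. So
      \<open>q\<close> divides \<open>h\<close>, hence equals it, contradicting the lowered exponent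
      at \<open>v\<close>.\<close>
    have "s \<notin> keys q"
      using ab kq st by (auto simp: insert_commute)
    have "mdvd q h"
      unfolding mdvd_def
    proof
      fix i
      have "lookup q i \<le> lookup f i" using q by (simp add: mdvd_def)
      then show "lookup q i \<le> lookup h i"
        using \<open>s \<notin> keys q\<close> by (cases "i = s") (auto simp: lf in_keys_iff split: if_splits)
    qed
    then have "q = h" using anti q h by blast
    then have "lookup h v \<le> lookup f v" using q by (simp add: mdvd_def)
    then show False using hv st by (simp add: lf)
  qed
  have t: "f + single t (lookup k t) \<in> upclosure n G"
  proof (rule upclosureI[OF k(1)])
    show "mdvd k (f + single t (lookup k t))"
      unfolding mdvd_def using ks by (auto simp: lookup_add lf lookup_single when_def)
  qed (use fn bounds in \<open>simp add: monomials_add single_monomials\<close>)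
  \<comment> \<open>Since \<open>lookup g v < lookup h v\<close>, the exponent of \<open>f\<close>
    at \<open>v\<close> still suffices for \<open>g\<close>; only the power at \<open>u\<close> is
    missing.\<close>
  have u: "f + single u (lookup g u) \<in> upclosure n G"
  proof (rule upclosureI[OF g(1)])
    show "mdvd g (f + single u (lookup g u))"
      unfolding mdvd_def
    proof
      fix i
      show "lookup g i \<le> lookup (f + single u (lookup g u)) i"
        using gs[of i] less by (cases "i = u"; cases "i = v") (auto simp: lookup_add lf lookup_single when_def)
    qed
  qed (use fn bounds in \<open>simp add: monomials_add single_monomials\<close>)
  have v: "f + single v 1 \<in> upclosure n G"
  proof (rule upclosureI[OF h(1)])
    show "mdvd h (f + single v 1)"
      unfolding mdvd_def by (auto simp: lookup_add lf lookup_single when_def)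
  qed (use fn bounds in \<open>simp add: monomials_add single_monomials\<close>)
  have "has_embedded_prime n (mspan (upclosure n G) :: 'k mpoly set)"
  proof (rule has_embedded_primeI[OF G fn \<open>f \<notin> upclosure n G\<close> \<open>u < n\<close>])
    show "{u} \<notin> keys ` G"
    proof
      assume "{u} \<in> keys ` G"
      then have "{u, u} \<in> cycle_edges n" using E by simp
      then show False using n2 unfolding cycle_edge_iff by simp
    qed
    show "\<exists>k. f + single u k \<in> upclosure n G" using u by blast
    fix e j assume e: "e \<in> keys ` G" "u \<in> e" "j \<in> e"
    have "e \<in> cycle_edges n" using e E by simp
    then obtain j' where "e = {j', u}" "{j', u} \<in> cycle_edges n"
      using cycle_edge_at[OF _ n2 e(2)] by metis
    then have "j = u \<or> {u, j} \<in> cycle_edges n" using e(3) by (auto simp: insert_commute)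
    then show "\<exists>k. f + single j k \<in> upclosure n G" using st(6) t u v by blast
  qed
  then show False using no by blast
qed

text \<open>Reading each path of two edges in both directions turns \<open>cycle_exponent_le\<close>
  into an equality, so all generators agree at a common vertex and the common exponents are the
  weights.\<close>

lemma cycle_weighting:
  assumes n: "n \<ge> 6" and G: "G \<subseteq> monomials n" "finite G"
    and anti: "\<And>g h. g \<in> G \<Longrightarrow> h \<in> G \<Longrightarrow> mdvd g h \<Longrightarrow> g = h"
    and E: "keys ` G = cycle_edges n"
    and no: "\<not> has_embedded_prime n (mspan (upclosure n G) :: 'k::field mpoly set)"
  shows "\<exists>d. (\<forall>i<n. 0 < d i) \<and> G = wgen d ` cycle_edges n"
proof -
  have le: "lookup h v \<le> lookup g v"
    if "g \<in> G" "h \<in> G" "keys g = {u, v}" "keys h = {v, w}" "u \<noteq> w" for g h u v w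
    by (rule cycle_exponent_le[OF n G _ E no that(1,3,2,4,5)]) (rule anti)
  have eq: "lookup h v = lookup g v"
    if "g \<in> G" "h \<in> G" "keys g = {u, v}" "keys h = {v, w}" "u \<noteq> w" for g h u v w
    using le[OF that] le[OF that(2,1), of w v u] that by (simp add: insert_commute)
  have same: "lookup h v = lookup g v" if gh: "g \<in> G" "h \<in> G" "v \<in> keys g" "v \<in> keys h" for g h v
  proof -
    have n2: "n \<ge> 2" using n by simp
    have "keys g \<in> cycle_edges n" "keys h \<in> cycle_edges n" using gh E by blast+
    then obtain u u' where u: "keys g = {u, v}" "{u, v} \<in> cycle_edges n" "keys h = {u', v}"
      using cycle_edge_at[OF _ n2] gh(3,4) by metis
    show ?thesis
    proof (cases "u = u'")
      case False
      then show ?thesis using eq[of g h u v u'] gh u by (simp add: insert_commute)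
    next
      case True
      \<comment> \<open>Two generators on the same edge are compared through a generator on the
        other edge at \<open>v\<close>.\<close>
      obtain w where w: "w \<noteq> u" "{v, w} \<in> cycle_edges n"
        using cycle_other_edge[of n u v] n u(2) by auto
      then obtain q where q: "q \<in> G" "keys q = {v, w}" using E by (metis imageE)
      have "lookup q v = lookup g v" "lookup q v = lookup h v"
        using eq[of g q u v w] eq[of h q u v w] gh u q w True by auto
      then show ?thesis by simp
    qed
  qed
  \<comment> \<open>The choice of generator does not matter: by \<open>same\<close>, all generators
    involving \<open>v\<close> have the same exponent there.\<close>
  define d where "d v = lookup (SOME g. g \<in> G \<and> v \<in> keys g) v" for v
  have d: "d v = lookup g v" if "g \<in> G" "v \<in> keys g" for g v
    using someI[of "\<lambda>g. g \<in> G \<and> v \<in> keys g" g] same that unfolding d_def by blast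
  have "0 < d v" if "v < n" for v
  proof -
    have "{v, Suc v mod n} \<in> cycle_edges n" using that by (auto simp: cycle_edges_def)
    then obtain g where "g \<in> G" "v \<in> keys g" using E by (metis imageE insertI1)
    then show ?thesis using d[of g v] by (simp add: in_keys_iff)
  qed
  moreover have "wgen d (keys g) = g" if "g \<in> G" for g
    using d[OF that] by (intro poly_mapping_eqI) (auto simp: lookup_wgen in_keys_iff)
  then have "G = wgen d ` cycle_edges n" unfolding E[symmetric] by force
  ultimately show ?thesis by blast
qed

section \<open>Colouring and covers of the cycle\<close>

lemma even_cycle_bipartite:
  assumes "even n" "e \<in> cycle_edges n"
  shows "\<exists>a b. e = {a, b} \<and> a < n \<and> b < n \<and> a \<in> {a. even a} \<and> b \<notin> {a. even a}"
proof -
  obtain i where i: "e = {i, Suc i mod n}" "i < n" using assms by (auto simp: cycle_edges_def)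
  then have p: "even (Suc i mod n) \<longleftrightarrow> odd i" "Suc i mod n < n" using assms by (auto simp: Suc_mod_eq)
  show ?thesis
  proof (cases "even i")
    case True
    then show ?thesis using i p by (intro exI[of _ i] exI[of _ "Suc i mod n"]) simp
  next
    case False
    then show ?thesis using i p by (intro exI[of _ "Suc i mod n"] exI[of _ i]) auto
  qed
qed

text \<open>Every vertex or its successor lies in \<open>C\<close>, and the successor map is
  injective, so two sets of size at most \<open>card C\<close> exhaust the cycle.\<close>

lemma cycle_cover_card:
  assumes "cover n (cycle_edges n) C"
  shows "n \<le> 2 * card C"
proof -
  let ?f = "\<lambda>i. Suc i mod n"
  have fin: "finite C" using assms by (auto simp: cover_def intro: finite_subset)
  have "{..<n} \<subseteq> C \<union> {i. i < n \<and> ?f i \<in> C}"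
  proof
    fix i assume "i \<in> {..<n}"
    then have "{i, ?f i} \<in> cycle_edges n" by (auto simp: cycle_edges_def)
    then have "{i, ?f i} \<inter> C \<noteq> {}" using assms by (auto simp: cover_def)
    then show "i \<in> C \<union> {i. i < n \<and> ?f i \<in> C}" using \<open>i \<in> {..<n}\<close> by auto
  qed
  then have "card {..<n} \<le> card (C \<union> {i. i < n \<and> ?f i \<in> C})"
    using fin by (intro card_mono) auto
  also have "\<dots> \<le> card C + card {i. i < n \<and> ?f i \<in> C}" by (rule card_Un_le)
  also have "card {i. i < n \<and> ?f i \<in> C} \<le> card C"
    using fin by (intro card_inj_on_le[of ?f]) (auto simp: inj_on_def Suc_mod_eq split: if_splits)
  finally show ?thesis by simp
qed

theorem theorem3p4:
  fixes n :: nat and I :: "('k::field) mpoly set"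
  assumes "n \<ge> 6"
    and "is_ideal n I" and "is_monomial_ideal n I"
    and "support2 n I"
    and "underlying_edges n I = cycle_edges n"
  shows "(\<not> has_embedded_prime n I \<longleftrightarrow> has_std_lin_weighting n I) \<and>
         ((\<forall>s\<ge>1. sym_pow n I s = ideal_pow n I s) \<longleftrightarrow> even n \<and> has_std_lin_weighting n I)"
proof -
  define G where "G = min_gens n I"
  define E where "E = cycle_edges n"
  have I: "I = mspan (upclosure n G)"
    unfolding G_def using assms(3) by (rule monomial_ideal_eq_mspan_min_gens)
  have G: "G \<subseteq> monomials n" by (auto simp: G_def min_gens_def)
  have GE: "keys ` G = E" using assms(5) by (simp add: G_def E_def underlying_edges_def)
  have anti: "g = h" if "g \<in> G" "h \<in> G" "mdvd g h" for g h
    using that by (auto simp: G_def min_gens_def)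
  have Edge: "e \<subseteq> {..<n} \<and> card e = 2" if "e \<in> E" for e
  proof -
    have "n \<ge> 2" using assms(1) by simp
    with that obtain i j where "e = {i, j}" "i < n" "j < n" "i \<noteq> j"
      unfolding E_def by (metis cycle_edgesE)
    then show ?thesis by simp
  qed
  \<comment> \<open>Each of the \<open>n\<close> edges carries a finite antichain of
    generators.\<close>
  have finG: "finite G"
  proof -
    have "G \<subseteq> (\<Union>i<n. {g \<in> G. keys g = {i, Suc i mod n}})"
    proof
      fix g assume g: "g \<in> G"
      then have "keys g \<in> cycle_edges n" using GE E_def by blast
      then show "g \<in> (\<Union>i<n. {g \<in> G. keys g = {i, Suc i mod n}})"
        using g by (auto simp: cycle_edges_def)
    qed
    moreover have "finite (\<Union>i<n. {g \<in> G. keys g = {i, Suc i mod n}})"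
      using anti by (intro finite_UN_I finite_antichain_two_variables) auto
    ultimately show ?thesis by (rule finite_subset)
  qed
  have keys_anti: "keys g = keys h" if "g \<in> G" "h \<in> G" "keys g \<subseteq> keys h" for g h
    using that Edge[of "keys g"] Edge[of "keys h"] GE by (intro card_subset_eq) auto
  have weighting: "has_std_lin_weighting n I \<longleftrightarrow>
      (\<exists>d. (\<forall>i<n. 0 < d i) \<and> I = mspan (upclosure n (wgen d ` E)))"
    unfolding I mspan_inject GE[symmetric] using G keys_anti by (rule has_std_lin_weighting_iff)
  have "has_std_lin_weighting n I" if no: "\<not> has_embedded_prime n I"
  proof -
    have "\<exists>d. (\<forall>i<n. 0 < d i) \<and> G = wgen d ` cycle_edges n"
      using assms(1) G finG anti GE[unfolded E_def] no[unfolded I] by (rule cycle_weighting)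
    then show ?thesis unfolding weighting using I by (metis E_def)
  qed
  moreover have "\<not> has_embedded_prime n I" if w: "has_std_lin_weighting n I"
  proof -
    obtain d where "\<And>i. i < n \<Longrightarrow> 0 < d i" "I = mspan (upclosure n (wgen d ` E))"
      using w unfolding weighting by blast
    then show ?thesis using weighted_no_embedded_prime[of E n d, where 'k='k] Edge by blast
  qed
  moreover have "\<not> has_embedded_prime n I" if "\<forall>s\<ge>1. sym_pow n I s = ideal_pow n I s"
    using that assms(2) by (intro sym_pow_one_no_embedded_prime) auto
  moreover have "(\<forall>s\<ge>1. sym_pow n I s = ideal_pow n I s) \<longleftrightarrow> even n" if w: "has_std_lin_weighting n I"
  proof -
    obtain d where d: "\<And>i. i < n \<Longrightarrow> 0 < d i" and Id: "I = mspan (upclosure n (wgen d ` E))"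
      using w unfolding weighting by blast
    show ?thesis
    proof
      assume "even n"
      have "sym_pow n I s = ideal_pow n I s" for s
        unfolding Id using even_cycle_bipartite[OF \<open>even n\<close>] d unfolding E_def
        by (rule weighted_bipartite_sym_pow_eq)
      then show "\<forall>s\<ge>1. sym_pow n I s = ideal_pow n I s" by blast
    next
      assume eq: "\<forall>s\<ge>1. sym_pow n I s = ideal_pow n I s"
      show "even n"
      proof (rule ccontr)
        assume "odd n"
        \<comment> \<open>For odd \<open>n\<close>, \<open>2 * ?s = n + 1\<close> exceeds
          \<open>n\<close>, while every cover has at least \<open>?s\<close> vertices.\<close>
        let ?s = "Suc n div 2"
        have "sym_pow n I ?s \<noteq> ideal_pow n I ?s"
          unfolding Id
        proof (rule weighted_sym_pow_neq[OF Edge d])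
          show "?s \<le> card C" if "cover n E C" for C
            using cycle_cover_card[of n C] that \<open>odd n\<close> by (auto simp: E_def elim!: oddE)
          show "n < 2 * ?s" using \<open>odd n\<close> by auto
        qed
        moreover have "?s \<ge> 1" using assms(1) by simp
        ultimately show False using eq by blast
      qed
    qed
  qed
  ultimately show ?thesis by blast
qed

end
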